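(* For each positive integer $m$, the following two assertions hold. (i) There exist a neighborhood $U$ of the origin $o\in\mathbb{R}^2$ and a space-like $C^\infty$-immersion $g:U\to\mathbb{L}^3$ such that: (1) $g$ has no umbilics on $U\setminus\{o\}$; (2) $o$ is an isolated singular point of each of the curvature line flows of $g$, with index $(3-m)/2$. (ii) There exist a neighborhood $U$ of the origin $o\in\mathbb{R}^2$ and a space-like $C^1$-immersion $g:U\to\mathbb{L}^3$ such that: (1) $g$ is $C^\infty$-differentiable and has no umbilics on $U\setminus\{o\}$; (2) $o$ is an isolated singular point of each of the curvature line flows of $g$ (defined on $U\setminus\{o\}$), with index $1+m/2$.
   Context: $\mathbb{L}^3$ is the Lorentz-Minkowski 3-space, i.e. $\mathbb{R}^3$ with the inner product $x_1y_1+x_2y_2-x_3y_3$ (signature $(++-)$). A ($C^1$-)immersion $g:U\to\mathbb{L}^3$ is space-like if its induced metric (first fundamental form) is positive definite at every point of $U$. Where $g$ is $C^\infty$, let $\nu$ be a (local) unit normal field ($|\nu\cdot\nu|=1$); the shape operator $A_g$ is the endomorphism of the tangent space with $d\nu=-dg\circ A_g$. A point is an umbilic if $A_g$ is a scalar multiple of the identity there. At a non-umbilic point of a space-like surface $A_g$ has exactly two eigen-directions (principal directions), orthogonal for the induced metric. If there are no umbilics on $U\setminus\{o\}$, then near $o$ these give two direction fields (fields of 1-dimensional tangent subspaces) on the punctured neighborhood; the two curvature line flows are the flows (foliations) they generate. The index at $o$ of such a flow is the total variation of the angle $\theta$ of the direction (spanned by $(\cos\theta,\sin\theta)$) along a small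 counterclockwise circle around $o$, divided by $2\pi$; it lies in $\frac12\mathbb{Z}$. That $o$ is an isolated singular point of the curvature line flows means that the flows are defined on a punctured neighborhood of $o$ and $o$ is regarded as their singular point; in case (i) $o$ is an (isolated) umbilic of $g$, and in case (ii), where $g$ is only assumed $C^1$ at $o$, $o$ is called a $C^1$-umbilic. *)

theory Defs
  imports "HOL-Analysis.Analysis"
begin

definition lorentz :: "real^3 \<Rightarrow> real^3 \<Rightarrow> real" where
  "lorentz x y = x $ 1 * y $ 1 + x $ 2 * y $ 2 - x $ 3 * y $ 3"

(* Meant for open S only. The recursion is on all directional derivatives, which by
   linearity is the same as on the partial derivatives. *)
primrec Ck_on :: "nat \<Rightarrow> 'a::euclidean_space set \<Rightarrow> ('a \<Rightarrow> 'b::euclidean_space) \<Rightarrow> bool" where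
  "Ck_on 0 S f \<longleftrightarrow> continuous_on S f"
| "Ck_on (Suc k) S f \<longleftrightarrow>
     (\<forall>x\<in>S. f differentiable (at x)) \<and>
     (\<forall>v. Ck_on k S (\<lambda>x. frechet_derivative f (at x) v))"

definition smooth_on :: "'a::euclidean_space set \<Rightarrow> ('a \<Rightarrow> 'b::euclidean_space) \<Rightarrow> bool" where
  "smooth_on S f \<longleftrightarrow> (\<forall>k. Ck_on k S f)"

abbreviation diff :: "('a::euclidean_space \<Rightarrow> 'b::euclidean_space) \<Rightarrow> 'a \<Rightarrow> 'a \<Rightarrow> 'b" where
  "diff f p \<equiv> frechet_derivative f (at p)"

definition C1_immersion :: "(real^2) set \<Rightarrow> (real^2 \<Rightarrow> real^3) \<Rightarrow> bool" where
  "C1_immersion U g \<longleftrightarrow> Ck_on 1 U g \<and> (\<forall>p\<in>U. inj (diff g p))"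

definition smooth_immersion :: "(real^2) set \<Rightarrow> (real^2 \<Rightarrow> real^3) \<Rightarrow> bool" where
  "smooth_immersion U g \<longleftrightarrow> smooth_on U g \<and> (\<forall>p\<in>U. inj (diff g p))"

definition first_fundamental_form ::
    "(real^2 \<Rightarrow> real^3) \<Rightarrow> real^2 \<Rightarrow> real^2 \<Rightarrow> real^2 \<Rightarrow> real" where
  "first_fundamental_form g p v w = lorentz (diff g p v) (diff g p w)"

definition space_like :: "(real^2) set \<Rightarrow> (real^2 \<Rightarrow> real^3) \<Rightarrow> bool" where
  "space_like U g \<longleftrightarrow> (\<forall>p\<in>U. \<forall>v. v \<noteq> 0 \<longrightarrow> first_fundamental_form g p v v > 0)"

definition unit_normal_field ::
    "(real^2 \<Rightarrow> real^3) \<Rightarrow> (real^2) set \<Rightarrow> (real^2 \<Rightarrow> real^3) \<Rightarrow> bool" where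
  "unit_normal_field g V \<nu> \<longleftrightarrow> smooth_on V \<nu> \<and>
     (\<forall>p\<in>V. \<bar>lorentz (\<nu> p) (\<nu> p)\<bar> = 1 \<and> (\<forall>v. lorentz (\<nu> p) (diff g p v) = 0))"

(* The tangent space at p is identified with the parameter space by the differential of g.
   For a smooth space-like immersion the relation determines A up to sign, the sign being
   that of the local unit normal; umbilics and principal directions do not depend on it. *)
definition shape_operator ::
    "(real^2 \<Rightarrow> real^3) \<Rightarrow> real^2 \<Rightarrow> (real^2 \<Rightarrow> real^2) \<Rightarrow> bool" where
  "shape_operator g p A \<longleftrightarrow> linear A \<and>
     (\<exists>V \<nu>. open V \<and> p \<in> V \<and> smooth_on V g \<and> unit_normal_field g V \<nu> \<and>
            (\<forall>v. diff \<nu> p v = - diff g p (A v)))"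

definition umbilic :: "(real^2 \<Rightarrow> real^3) \<Rightarrow> real^2 \<Rightarrow> bool" where
  "umbilic g p \<longleftrightarrow> (\<exists>A c. shape_operator g p A \<and> (\<forall>v. A v = c *\<^sub>R v))"

definition principal_direction :: "(real^2 \<Rightarrow> real^3) \<Rightarrow> real^2 \<Rightarrow> (real^2) set \<Rightarrow> bool" where
  "principal_direction g p l \<longleftrightarrow>
     (\<exists>A v c. shape_operator g p A \<and> v \<noteq> 0 \<and> A v = c *\<^sub>R v \<and> l = span {v})"

definition direction_field :: "(real^2) set \<Rightarrow> (real^2 \<Rightarrow> (real^2) set) \<Rightarrow> bool" where
  "direction_field D L \<longleftrightarrow>
     (\<forall>p\<in>D. \<exists>W v. open W \<and> p \<in> W \<and> W \<subseteq> D \<and> continuous_on W v \<and>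
        (\<forall>q\<in>W. v q \<noteq> 0 \<and> L q = span {v q}))"

(* A flow is represented by its field of tangent directions. On a connected D without
   umbilics, L1 and L2 are unique up to being interchanged. *)
definition curvature_line_flows ::
    "(real^2 \<Rightarrow> real^3) \<Rightarrow> (real^2) set \<Rightarrow> (real^2 \<Rightarrow> (real^2) set) \<Rightarrow>
     (real^2 \<Rightarrow> (real^2) set) \<Rightarrow> bool" where
  "curvature_line_flows g D L1 L2 \<longleftrightarrow> direction_field D L1 \<and> direction_field D L2 \<and>
     (\<forall>p\<in>D. L1 p \<noteq> L2 p \<and> {l. principal_direction g p l} = {L1 p, L2 p})"

definition unit_vec :: "real \<Rightarrow> real^2" where
  "unit_vec t = vector [cos t, sin t]"

(* The angle is determined up to adding a constant multiple of pi, so its total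
   variation does not depend on the choice. *)
definition has_index_at_origin :: "(real^2 \<Rightarrow> (real^2) set) \<Rightarrow> real \<Rightarrow> bool" where
  "has_index_at_origin L q \<longleftrightarrow>
     (\<exists>\<epsilon>>0. \<forall>r. 0 < r \<and> r < \<epsilon> \<longrightarrow>
        (\<exists>\<theta> :: real \<Rightarrow> real. continuous_on {0..2*pi} \<theta> \<and>
           (\<forall>t\<in>{0..2*pi}. L (r *\<^sub>R unit_vec t) = span {unit_vec (\<theta> t)}) \<and>
           (\<theta> (2*pi) - \<theta> 0) / (2*pi) = q))"

end

theory Submission
  imports Defs
begin

text \<open>Both surfaces are graphs of functions \<open>f\<close> that are homogeneous of degree \<open>d > 1\<close>
  and smooth off the origin. The gradient of \<open>f\<close> has order \<open>r powr (d - 1)\<close>, so the first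
  fundamental form is the Euclidean one up to terms of relative order \<open>r powr (2 * (d - 1))\<close>,
  and on small circles the principal directions are perturbations of those of the Hessian.
  Their index is half of the winding number of \<open>f_xx - f_yy + 2 i f_xy\<close> along the unit circle,
  provided that this function has no zero there.

  For (i), \<open>f = r ^ 4 Re (z ^ (m - 1))\<close> has winding number \<open>3 - m\<close>. For (ii), a function
  \<open>r powr d * G (m * t)\<close> of the polar coordinates, with \<open>1 < d < 2\<close>, has winding number
  \<open>2 + m\<close> if \<open>G\<close> oscillates like the cosine but has vanishing second derivative at its extrema;
  we take \<open>d = 3 / 2\<close> and
  \<open>G s = 9 * cos s - cos (3 * s) = 12 * (cos s - cos s ^ 3 / 3)\<close>.\<close>

section \<open>Smoothness\<close>

text \<open>For \<open>f = r powr d * g t\<close>, the function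
  \<open>f_xx - f_yy + 2 i f_xy\<close> is \<open>r powr (d - 2) * cis (2 * t)\<close> times the
  bracket \<open>- d * (2 - d) * g - g'' + 2 i (d - 1) g'\<close>. If
  \<open>g t = cos (k * t)\<close> with \<open>k >= 1\<close>, the bracket is
  \<open>A * cis (- k * t) + B * cis (k * t)\<close> with \<open>A + B = k^2 - d * (2 - d)\<close>
  and \<open>A - B = 2 * k * (d - 1)\<close>. Both are positive for \<open>d > 1\<close>, so the
  first term dominates and the winding number is \<open>2 - k\<close>: good for (i), but never
  \<open>2 + m\<close>. This is the obstacle in (ii). Where \<open>g' = 0\<close>, the sign of the
  real part decides the sense of rotation; flat extrema remove \<open>g''\<close> there and leave
  \<open>- d * (2 - d) * g\<close>, opposite in sign to \<open>g\<close> because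
  \<open>d < 2\<close>. The coefficient 9 = 3^2 makes the second derivatives of
  \<open>9 * cos s\<close> and \<open>cos (3 * s)\<close> cancel at the extrema. In (i), the factor
  \<open>r ^ 4\<close> serves small exponents: \<open>Re (z ^ k)\<close> has zero Hessian for
  \<open>k = 0, 1\<close>, and the Hessian of \<open>r ^ 2\<close> is a multiple of the
  identity.\<close>

lemma Ck_on_cong:
  assumes "open S" "\<And>x. x \<in> S \<Longrightarrow> f x = g x" "Ck_on k S f"
  shows "Ck_on k S g"
  using assms(2,3)
proof (induction k arbitrary: f g)
  case 0
  then show ?case using continuous_on_cong[of S S f g] by simp
next
  case (Suc k)
  have der: "(g has_derivative frechet_derivative f (at x)) (at x)" if "x \<in> S" for x
  proof -
    have "(f has_derivative frechet_derivative f (at x)) (at x)"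
      using Suc.prems(2) that frechet_derivative_works by auto
    then show ?thesis
      using has_derivative_transform_within_open[OF _ assms(1) that] Suc.prems(1) by blast
  qed
  have eq: "frechet_derivative f (at x) v = frechet_derivative g (at x) v" if "x \<in> S" for x v
    using frechet_derivative_at[OF der[OF that]] by simp
  have "Ck_on k S (\<lambda>x. frechet_derivative g (at x) v)" for v
  proof (rule Suc.IH[of "\<lambda>x. frechet_derivative f (at x) v"])
    show "Ck_on k S (\<lambda>x. frechet_derivative f (at x) v)"
      using Suc.prems(2) unfolding Ck_on.simps by blast
  qed (rule eq)
  moreover have "g differentiable (at x)" if "x \<in> S" for x
    using der[OF that] by (auto simp: differentiable_def)
  ultimately show ?case
    by simp
qed

text \<open>By uniqueness of the derivative, any explicit derivative can stand in for the
  \<open>frechet_derivative\<close> through which \<open>Ck_on\<close> recurses; the closure rules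
  below are inductions through this.\<close>

lemma Ck_on_SucI:
  assumes "open S" "\<And>x. x \<in> S \<Longrightarrow> (f has_derivative f' x) (at x)"
    "\<And>v. Ck_on k S (\<lambda>x. f' x v)"
  shows "Ck_on (Suc k) S f"
  unfolding Ck_on.simps
proof (intro conjI ballI allI)
  fix x assume "x \<in> S"
  then show "f differentiable (at x)" using assms(2) by (auto simp: differentiable_def)
next
  fix v
  have "f' x v = frechet_derivative f (at x) v" if "x \<in> S" for x
    using frechet_derivative_at[OF assms(2)[OF that]] by simp
  then show "Ck_on k S (\<lambda>x. frechet_derivative f (at x) v)"
    by (rule Ck_on_cong[OF assms(1) _ assms(3)[of v]])
qed

lemma Ck_on_Suc_has_derivative:
  assumes "Ck_on (Suc k) S f" "x \<in> S"
  shows "(f has_derivative frechet_derivative f (at x)) (at x)"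
  using assms frechet_derivative_works by auto

lemma Ck_on_Suc_imp_Ck_on: "Ck_on (Suc k) S f \<Longrightarrow> Ck_on k S f"
proof (induction k arbitrary: f)
  case 0
  then show ?case
    by (auto intro!: continuous_at_imp_continuous_on differentiable_imp_continuous_within)
next
  case (Suc k)
  then show ?case by (metis Ck_on.simps(2))
qed

lemma Ck_on_const: "open S \<Longrightarrow> Ck_on k S (\<lambda>x. c)"
proof (induction k arbitrary: c)
  case (Suc k)
  show ?case
    by (rule Ck_on_SucI[OF Suc.prems, where f' = "\<lambda>x v. 0"]) (auto intro: Suc)
qed auto

lemma Ck_on_bounded_linear_compose:
  assumes "bounded_linear h" "open S"
  shows "Ck_on k S f \<Longrightarrow> Ck_on k S (\<lambda>x. h (f x))"
proof (induction k arbitrary: f)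
  case 0
  then show ?case using bounded_linear.continuous_on[OF assms(1)] by auto
next
  case (Suc k)
  show ?case
    by (rule Ck_on_SucI[OF assms(2), where f' = "\<lambda>x v. h (frechet_derivative f (at x) v)"])
      (blast intro: bounded_linear.has_derivative[OF assms(1)]
        Ck_on_Suc_has_derivative[OF Suc.prems],
       rule Suc.IH, metis Suc.prems Ck_on.simps(2))
qed

lemma Ck_on_bounded_linear:
  assumes "bounded_linear h" "open S"
  shows "Ck_on k S h"
proof (cases k)
  case 0
  then show ?thesis using assms by (auto simp: linear_continuous_on)
next
  case (Suc j)
  show ?thesis unfolding Suc
    by (rule Ck_on_SucI[OF assms(2), where f' = "\<lambda>x v. h v"])
      (use assms in \<open>auto intro: bounded_linear_imp_has_derivative Ck_on_const\<close>)
qed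

lemma Ck_on_add:
  assumes "open S"
  shows "Ck_on k S f \<Longrightarrow> Ck_on k S g \<Longrightarrow> Ck_on k S (\<lambda>x. f x + g x)"
proof (induction k arbitrary: f g)
  case 0
  then show ?case by (simp add: continuous_on_add)
next
  case (Suc k)
  show ?case
    by (rule Ck_on_SucI[OF assms,
          where f' = "\<lambda>x v. frechet_derivative f (at x) v + frechet_derivative g (at x) v"])
      (blast intro: has_derivative_add Ck_on_Suc_has_derivative[OF Suc.prems(1)]
        Ck_on_Suc_has_derivative[OF Suc.prems(2)],
       rule Suc.IH, (metis Suc.prems Ck_on.simps(2))+)
qed

lemma Ck_on_mult:
  fixes f g :: "'a::euclidean_space \<Rightarrow> real"
  assumes "open S"
  shows "Ck_on k S f \<Longrightarrow> Ck_on k S g \<Longrightarrow> Ck_on k S (\<lambda>x. f x * g x)"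
proof (induction k arbitrary: f g)
  case 0
  then show ?case by (simp add: continuous_on_mult)
next
  case (Suc k)
  show ?case
  proof (rule Ck_on_SucI[OF assms,
          where f' = "\<lambda>x v. f x * frechet_derivative g (at x) v + frechet_derivative f (at x) v * g x"])
    fix x assume "x \<in> S"
    then show "((\<lambda>x. f x * g x) has_derivative
       (\<lambda>v. f x * frechet_derivative g (at x) v + frechet_derivative f (at x) v * g x)) (at x)"
      by (intro has_derivative_mult Ck_on_Suc_has_derivative[OF Suc.prems(1)]
          Ck_on_Suc_has_derivative[OF Suc.prems(2)])
  next
    fix v
    show "Ck_on k S (\<lambda>x. f x * frechet_derivative g (at x) v + frechet_derivative f (at x) v * g x)"
      by (intro Ck_on_add assms Suc.IH Suc.prems[THEN Ck_on_Suc_imp_Ck_on])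
        (metis Suc.prems Ck_on.simps(2))+
  qed
qed

text \<open>The exponent varies in the induction, since differentiating lowers it by one; positivity
  of \<open>f\<close> keeps every real exponent admissible.\<close>

lemma Ck_on_powr:
  fixes f :: "'a::euclidean_space \<Rightarrow> real"
  assumes "open S" "\<And>x. x \<in> S \<Longrightarrow> f x > 0"
  shows "Ck_on k S f \<Longrightarrow> Ck_on k S (\<lambda>x. f x powr e)"
proof (induction k arbitrary: e)
  case 0
  have "f x \<noteq> 0" if "x \<in> S" for x
    using assms(2)[OF that] by simp
  with 0 show ?case by (auto intro: continuous_on_powr continuous_on_const)
next
  case (Suc k)
  show ?case
  proof (rule Ck_on_SucI[OF assms(1),
          where f' = "\<lambda>x v. (e * f x powr (e - 1)) * frechet_derivative f (at x) v"])
    fix x assume x: "x \<in> S"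
    show "((\<lambda>x. f x powr e) has_derivative
       (\<lambda>v. (e * f x powr (e - 1)) * frechet_derivative f (at x) v)) (at x)"
      using has_derivative_compose[OF Ck_on_Suc_has_derivative[OF Suc.prems x],
          of "\<lambda>y. y powr e"] has_real_derivative_powr[OF assms(2)[OF x], of e]
      by (simp add: has_field_derivative_def)
  next
    fix v
    show "Ck_on k S (\<lambda>x. (e * f x powr (e - 1)) * frechet_derivative f (at x) v)"
      by (intro Ck_on_mult assms Suc.IH Ck_on_const Suc.prems[THEN Ck_on_Suc_imp_Ck_on])
        (metis Suc.prems Ck_on.simps(2))
  qed
qed

section \<open>Restriction to subsets, and the closure rules for smooth functions\<close>

lemma Ck_on_subset: "Ck_on k T f \<Longrightarrow> S \<subseteq> T \<Longrightarrow> Ck_on k S f"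
proof (induction k arbitrary: f)
  case 0
  then show ?case using continuous_on_subset by auto
next
  case (Suc k)
  then show ?case by (metis Ck_on.simps(2) subsetD)
qed

lemma smooth_on_subset: "smooth_on T f \<Longrightarrow> S \<subseteq> T \<Longrightarrow> smooth_on S f"
  unfolding smooth_on_def by (blast intro: Ck_on_subset)

lemma smooth_on_cong:
  "open S \<Longrightarrow> (\<And>x. x \<in> S \<Longrightarrow> f x = g x) \<Longrightarrow> smooth_on S f \<Longrightarrow> smooth_on S g"
  unfolding smooth_on_def using Ck_on_cong[of S f g] by blast

lemma smooth_on_const: "open S \<Longrightarrow> smooth_on S (\<lambda>x. c)"
  and smooth_on_bounded_linear: "bounded_linear h \<Longrightarrow> open S \<Longrightarrow> smooth_on S h"
  and smooth_on_bounded_linear_compose: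
    "bounded_linear h' \<Longrightarrow> open S \<Longrightarrow> smooth_on S f \<Longrightarrow> smooth_on S (\<lambda>x. h' (f x))"
  and smooth_on_add:
    "open S \<Longrightarrow> smooth_on S f \<Longrightarrow> smooth_on S g \<Longrightarrow> smooth_on S (\<lambda>x. f x + g x)"
  unfolding smooth_on_def
  by (auto intro: Ck_on_const Ck_on_bounded_linear Ck_on_bounded_linear_compose Ck_on_add)

lemma smooth_on_mult:
  fixes f g :: "'a::euclidean_space \<Rightarrow> real"
  shows "open S \<Longrightarrow> smooth_on S f \<Longrightarrow> smooth_on S g \<Longrightarrow> smooth_on S (\<lambda>x. f x * g x)"
  and smooth_on_powr:
    "open S \<Longrightarrow> (\<And>x. x \<in> S \<Longrightarrow> f x > 0) \<Longrightarrow> smooth_on S f \<Longrightarrow> smooth_on S (\<lambda>x. f x powr e)"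
  unfolding smooth_on_def by (auto intro: Ck_on_mult Ck_on_powr)

lemma smooth_on_frechet_derivative:
  "smooth_on S f \<Longrightarrow> smooth_on S (\<lambda>x. frechet_derivative f (at x) v)"
  unfolding smooth_on_def by (metis Ck_on.simps(2))

lemma smooth_on_has_derivative:
  "smooth_on S f \<Longrightarrow> x \<in> S \<Longrightarrow> (f has_derivative frechet_derivative f (at x)) (at x)"
  unfolding smooth_on_def by (rule Ck_on_Suc_has_derivative[of 0]) auto

section \<open>Graphs in the Lorentz-Minkowski space\<close>

definition graph_map :: "(real^2 \<Rightarrow> real) \<Rightarrow> real^2 \<Rightarrow> real^3" where
  "graph_map f x = vector [x $ 1, x $ 2, f x]"

lemma vec2_eq_iff: "(x::'a^2) = y \<longleftrightarrow> x $ 1 = y $ 1 \<and> x $ 2 = y $ 2"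
  and vec3_eq_iff: "(u::'a^3) = w \<longleftrightarrow> u $ 1 = w $ 1 \<and> u $ 2 = w $ 2 \<and> u $ 3 = w $ 3"
  by (auto simp: vec_eq_iff forall_2 forall_3)

lemma vec2_component [simp]:
  "(vector [a, b] :: 'a::zero^2) $ 1 = a" "(vector [a, b] :: 'a::zero^2) $ 2 = b"
  by (simp_all add: vector_2)

lemma vector3_axis:
  "(vector [a, b, c] :: real^3) = a *\<^sub>R axis 1 1 + b *\<^sub>R axis 2 1 + c *\<^sub>R axis 3 1"
  by (simp add: vec3_eq_iff vector_3 axis_def)

lemma has_derivative_vector3:
  assumes "(f has_derivative f') F" "(g has_derivative g') F" "(h has_derivative h') F"
  shows "((\<lambda>x. vector [f x, g x, h x] :: real^3) has_derivative (\<lambda>v. vector [f' v, g' v, h' v])) F"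
  unfolding vector3_axis by (intro derivative_intros assms)

lemma smooth_on_vector3:
  assumes "open S" "smooth_on S f" "smooth_on S g" "smooth_on S h"
  shows "smooth_on S (\<lambda>x. vector [f x, g x, h x] :: real^3)"
  unfolding vector3_axis
  by (intro smooth_on_add smooth_on_bounded_linear_compose[of "\<lambda>t. t *\<^sub>R _"] assms
      bounded_linear_scaleR_left)

lemma graph_map_has_derivative:
  assumes "(f has_derivative f') (at x)"
  shows "(graph_map f has_derivative (\<lambda>v. vector [v $ 1, v $ 2, f' v])) (at x)"
  unfolding graph_map_def
  by (intro has_derivative_vector3 assms bounded_linear_imp_has_derivative bounded_linear_vec_nth)

lemma smooth_on_graph_map:
  assumes "open S" "smooth_on S f"
  shows "smooth_on S (graph_map f)"
  unfolding graph_map_def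
  by (intro smooth_on_vector3 assms smooth_on_bounded_linear bounded_linear_vec_nth)

text \<open>\<open>(p, q)\<close> is the gradient and \<open>a\<close>, \<open>b\<close>,
  \<open>c\<close> are the entries of the Hessian, kept explicit for computation. The shared
  \<open>b\<close> is the symmetry of second derivatives, and \<open>grad\<close> makes the tangent
  planes space-like.\<close>

locale lorentz_graph =
  fixes S :: "(real^2) set" and f p q a b c :: "real^2 \<Rightarrow> real"
  assumes open_S: "open S"
    and smooth: "smooth_on S f"
    and deriv_f: "\<And>x. x \<in> S \<Longrightarrow> (f has_derivative (\<lambda>v. p x * v $ 1 + q x * v $ 2)) (at x)"
    and deriv_p: "\<And>x. x \<in> S \<Longrightarrow> (p has_derivative (\<lambda>v. a x * v $ 1 + b x * v $ 2)) (at x)"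
    and deriv_q: "\<And>x. x \<in> S \<Longrightarrow> (q has_derivative (\<lambda>v. b x * v $ 1 + c x * v $ 2)) (at x)"
    and grad: "\<And>x. x \<in> S \<Longrightarrow> (p x)\<^sup>2 + (q x)\<^sup>2 < 1"
begin

lemma diff_graph:
  assumes "x \<in> S"
  shows "diff (graph_map f) x = (\<lambda>v. vector [v $ 1, v $ 2, p x * v $ 1 + q x * v $ 2])"
  using frechet_derivative_at[OF graph_map_has_derivative[OF deriv_f[OF assms]]] by simp

definition fstform :: "real^2 \<Rightarrow> real^2 \<Rightarrow> real^2 \<Rightarrow> real" where
  "fstform x v w = v $ 1 * w $ 1 + v $ 2 * w $ 2
     - (p x * v $ 1 + q x * v $ 2) * (p x * w $ 1 + q x * w $ 2)"

definition hess :: "real^2 \<Rightarrow> real^2 \<Rightarrow> real^2 \<Rightarrow> real" where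
  "hess x v w = (a x * v $ 1 + b x * v $ 2) * w $ 1 + (b x * v $ 1 + c x * v $ 2) * w $ 2"

lemma first_fundamental_form_graph:
  "x \<in> S \<Longrightarrow> first_fundamental_form (graph_map f) x v w = fstform x v w"
  unfolding first_fundamental_form_def fstform_def lorentz_def
  by (simp add: diff_graph vector_3)

lemma fstform_pos:
  assumes "x \<in> S" "v \<noteq> 0"
  shows "fstform x v v > 0"
proof -
  \<comment> \<open>Lagrange's identity; discarding the second square leaves the Cauchy-Schwarz
    inequality.\<close>
  have "(p x * v $ 1 + q x * v $ 2)\<^sup>2 + (p x * v $ 2 - q x * v $ 1)\<^sup>2
      = ((p x)\<^sup>2 + (q x)\<^sup>2) * ((v $ 1)\<^sup>2 + (v $ 2)\<^sup>2)"
    by algebra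
  moreover have "(v $ 1)\<^sup>2 + (v $ 2)\<^sup>2 > 0"
    using assms(2) by (auto simp: vec2_eq_iff sum_power2_gt_zero_iff)
  then have "((p x)\<^sup>2 + (q x)\<^sup>2) * ((v $ 1)\<^sup>2 + (v $ 2)\<^sup>2) < (v $ 1)\<^sup>2 + (v $ 2)\<^sup>2"
    using grad[OF assms(1)] by simp
  moreover have "(p x * v $ 2 - q x * v $ 1)\<^sup>2 \<ge> 0" by simp
  ultimately have "(p x * v $ 1 + q x * v $ 2)\<^sup>2 < (v $ 1)\<^sup>2 + (v $ 2)\<^sup>2"
    by linarith
  then show ?thesis unfolding fstform_def by (simp add: power2_eq_square)
qed

lemma space_like_graph: "space_like S (graph_map f)"
  unfolding space_like_def by (simp add: first_fundamental_form_graph fstform_pos)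

lemma inj_diff_graph: "x \<in> S \<Longrightarrow> inj (diff (graph_map f) x)"
  unfolding inj_def by (auto simp: diff_graph vec2_eq_iff vec3_eq_iff vector_3)

lemma smooth_immersion_graph: "smooth_immersion S (graph_map f)"
  unfolding smooth_immersion_def
  using smooth_on_graph_map[OF open_S smooth] inj_diff_graph by blast

lemma smooth_gradient: "smooth_on S p" "smooth_on S q"
proof -
  have "frechet_derivative f (at x) v = p x * v $ 1 + q x * v $ 2" if "x \<in> S" for x v
    using frechet_derivative_at[OF deriv_f[OF that]] by metis
  then have *: "smooth_on S (\<lambda>x. p x * v $ 1 + q x * v $ 2)" for v :: "real^2"
    using smooth_on_cong[OF open_S _ smooth_on_frechet_derivative[OF smooth, of v],
        of "\<lambda>x. p x * v $ 1 + q x * v $ 2"] by blast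
  show "smooth_on S p" using *[of "vector [1, 0]"] by simp
  show "smooth_on S q" using *[of "vector [0, 1]"] by simp
qed

lemma fstform_zero:
  assumes "x \<in> S" "\<And>w. fstform x v w = 0"
  shows "v = 0"
  using fstform_pos[OF assms(1), of v] assms(2)[of v] by force

text \<open>The second fundamental form of a graph is a multiple of the Hessian, because the
  second derivatives of the graph are vertical.\<close>

lemma shape_operator_hess:
  assumes "x \<in> S" "shape_operator (graph_map f) x A"
  obtains \<kappa> where "\<kappa> \<noteq> 0" "\<And>v w. fstform x (A v) w = \<kappa> * hess x v w"
proof -
  from assms(2) obtain V \<nu> where V: "open V" "x \<in> V"
    and \<nu>: "unit_normal_field (graph_map f) V \<nu>"
    and A: "\<And>v. diff \<nu> x v = - diff (graph_map f) x (A v)"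
    unfolding shape_operator_def by blast
  let ?D = "diff \<nu> x"
  have D: "(\<nu> has_derivative ?D) (at x)"
    using \<nu> V smooth_on_has_derivative unfolding unit_normal_field_def by blast
  have Di: "((\<lambda>y. \<nu> y $ i) has_derivative (\<lambda>v. ?D v $ i)) (at x)" for i
    using bounded_linear.has_derivative[OF bounded_linear_vec_nth D] .
  have orth: "\<nu> y $ 1 * w $ 1 + \<nu> y $ 2 * w $ 2 - \<nu> y $ 3 * (p y * w $ 1 + q y * w $ 2) = 0"
    if "y \<in> V \<inter> S" for y and w :: "real^2"
    using \<nu> that unfolding unit_normal_field_def lorentz_def
    by (auto simp: diff_graph vector_3 dest!: bspec[of V _ y])
  have main: "fstform x (A v) w = - \<nu> x $ 3 * hess x v w" for v w
  proof -
    \<comment> \<open>\<open>?h\<close> is the product of the normal with the tangent vector in the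
      fixed coordinate direction \<open>w\<close>, hence zero near \<open>x\<close>. In its
      derivative along \<open>v\<close>, the terms with \<open>?D v\<close> give
      \<open>- fstform x (A v) w\<close> and the rest gives
      \<open>- \<nu> x $ 3 * hess x v w\<close>.\<close>
    let ?h = "\<lambda>y. \<nu> y $ 1 * w $ 1 + \<nu> y $ 2 * w $ 2 - \<nu> y $ 3 * (p y * w $ 1 + q y * w $ 2)"
    let ?h' = "\<lambda>v. ?D v $ 1 * w $ 1 + ?D v $ 2 * w $ 2
      - (\<nu> x $ 3 * ((a x * v $ 1 + b x * v $ 2) * w $ 1 + (b x * v $ 1 + c x * v $ 2) * w $ 2)
        + ?D v $ 3 * (p x * w $ 1 + q x * w $ 2))"
    have "(?h has_derivative ?h') (at x)"
      using assms(1) by (intro has_derivative_diff has_derivative_add has_derivative_mult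
          has_derivative_mult_left Di deriv_p deriv_q)
    moreover have "((\<lambda>y. 0) has_derivative (\<lambda>v. 0 :: real)) (at x)" by simp
    then have "(?h has_derivative (\<lambda>v. 0)) (at x)"
      by (rule has_derivative_transform_within_open[of _ _ _ _ "V \<inter> S"])
        (use V open_S assms(1) orth in auto)
    ultimately have "?h' = (\<lambda>v. 0)"
      using has_derivative_unique by blast
    then have "?h' v = 0" by (rule fun_cong)
    then show ?thesis
      unfolding fstform_def hess_def A
      by (simp add: diff_graph[OF assms(1)] vector_3 algebra_simps)
  qed
  have "\<nu> x $ 3 \<noteq> 0"
  proof
    assume 0: "\<nu> x $ 3 = 0"
    have "\<nu> x $ 1 * w $ 1 + \<nu> x $ 2 * w $ 2 = 0" for w :: "real^2"
      using orth[of x w] V assms(1) 0 by auto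
    from this[of "vector [1, 0]"] this[of "vector [0, 1]"]
    have "lorentz (\<nu> x) (\<nu> x) = 0" unfolding lorentz_def using 0 by simp
    then show False using \<nu> V unfolding unit_normal_field_def by force
  qed
  then show ?thesis using that[of "- \<nu> x $ 3"] main by auto
qed

text \<open>\<open>shape_operator\<close> is a relation, so the converse directions below need a
  witness. The field \<open>(p, q, 1) / sqrt (1 - p^2 - q^2)\<close> is a smooth normal of Lorentz
  square -1. Its derivative is tangent because that square is constant, and a tangent vector of a
  graph is determined by its first two components, from which \<open>A\<close> is read off.\<close>

lemma shape_operator_exists:
  assumes "x \<in> S"
  obtains A where "shape_operator (graph_map f) x A"
proof -
  define l where "l y = (1 + (- 1) * (p y * p y + q y * q y)) powr (- 1 / 2)" for y
  define \<nu> where "\<nu> y = (vector [l y * p y, l y * q y, l y] :: real^3)" for y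
  have pos: "1 + (- 1) * (p y * p y + q y * q y) > 0" if "y \<in> S" for y
    using grad[OF that] by (simp add: power2_eq_square)
  have l2: "l y * l y * (1 - (p y * p y + q y * q y)) = 1" if "y \<in> S" for y
    unfolding l_def using pos[OF that] by (simp flip: powr_add add: powr_minus field_simps)
  have smooth_l: "smooth_on S l"
    unfolding l_def using pos
    by (intro smooth_on_powr smooth_on_add smooth_on_mult smooth_on_const smooth_gradient open_S)
  have smooth_\<nu>: "smooth_on S \<nu>"
    unfolding \<nu>_def by (intro smooth_on_vector3 smooth_on_mult smooth_l smooth_gradient open_S)
  have lor: "lorentz (\<nu> y) (\<nu> y) = - 1" if "y \<in> S" for y
    using l2[OF that] unfolding lorentz_def \<nu>_def by (simp add: vector_3 algebra_simps)
  have normal: "unit_normal_field (graph_map f) S \<nu>"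
    unfolding unit_normal_field_def
  proof (intro conjI ballI allI smooth_\<nu>)
    fix y v assume y: "y \<in> S"
    show "\<bar>lorentz (\<nu> y) (\<nu> y)\<bar> = 1" using lor[OF y] by simp
    show "lorentz (\<nu> y) (diff (graph_map f) y v) = 0"
      unfolding lorentz_def \<nu>_def by (simp add: diff_graph[OF y] vector_3 algebra_simps)
  qed
  let ?D = "diff \<nu> x"
  have D: "(\<nu> has_derivative ?D) (at x)"
    using smooth_\<nu> assms smooth_on_has_derivative by blast
  have Di: "((\<lambda>y. \<nu> y $ i) has_derivative (\<lambda>v. ?D v $ i)) (at x)" for i
    using bounded_linear.has_derivative[OF bounded_linear_vec_nth D] .
  define A where "A v = (- (?D v $ 1)) *\<^sub>R axis 1 1 + (- (?D v $ 2)) *\<^sub>R (axis 2 1 :: real^2)" for v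
  have A12: "A v $ 1 = - (?D v $ 1)" "A v $ 2 = - (?D v $ 2)" for v
    unfolding A_def by (simp_all add: axis_def)
  have tangent: "?D v $ 3 = p x * ?D v $ 1 + q x * ?D v $ 2" for v
  proof -
    let ?h = "\<lambda>y. \<nu> y $ 1 * \<nu> y $ 1 + \<nu> y $ 2 * \<nu> y $ 2 - \<nu> y $ 3 * \<nu> y $ 3"
    let ?h' = "\<lambda>v. (\<nu> x $ 1 * ?D v $ 1 + ?D v $ 1 * \<nu> x $ 1)
       + (\<nu> x $ 2 * ?D v $ 2 + ?D v $ 2 * \<nu> x $ 2) - (\<nu> x $ 3 * ?D v $ 3 + ?D v $ 3 * \<nu> x $ 3)"
    have "(?h has_derivative ?h') (at x)"
      by (intro has_derivative_diff has_derivative_add has_derivative_mult Di)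
    moreover have "((\<lambda>y. - 1 :: real) has_derivative (\<lambda>v. 0 :: real)) (at x)" by simp
    then have "(?h has_derivative (\<lambda>v. 0)) (at x)"
      by (rule has_derivative_transform_within_open[of _ _ _ _ S])
        (use open_S assms lor in \<open>auto simp: lorentz_def\<close>)
    ultimately have "?h' = (\<lambda>v. 0)"
      using has_derivative_unique by blast
    then have "?h' v = 0" by (rule fun_cong)
    then have "l x * (p x * ?D v $ 1 + q x * ?D v $ 2 - ?D v $ 3) = 0"
      unfolding \<nu>_def[of x] by (simp add: vector_3 algebra_simps)
    moreover have "l x \<noteq> 0" using l2[OF assms] by auto
    ultimately show ?thesis by simp
  qed
  have "shape_operator (graph_map f) x A"
    unfolding shape_operator_def
  proof (intro conjI exI[of _ S] exI[of _ \<nu>] allI)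
    have "bounded_linear (\<lambda>v. ?D v $ i)" for i
      using Di has_derivative_bounded_linear by blast
    then show "linear A"
      unfolding A_def linear_conv_bounded_linear
      by (intro bounded_linear_add bounded_linear_scaleR_const bounded_linear_minus)
    show "?D v = - diff (graph_map f) x (A v)" for v
      by (simp add: diff_graph[OF assms] vec3_eq_iff vector_3 A12 tangent)
  qed (use open_S assms normal smooth_on_graph_map smooth in auto)
  then show ?thesis using that by blast
qed

text \<open>Through the metric, the shape operator is \<open>hess\<close> up to a nonzero factor
  \<kappa>, which the constant \<open>k\<close> absorbs; so the choice of normal does not matter.
  Conversely, nondegeneracy of \<open>fstform\<close> recovers \<open>A v\<close> from its pairings
  with all \<open>w\<close>.\<close>

lemma umbilic_graph_iff:
  assumes "x \<in> S"
  shows "umbilic (graph_map f) x \<longleftrightarrow> (\<exists>k. \<forall>v w. hess x v w = k * fstform x v w)"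
proof
  assume "umbilic (graph_map f) x"
  then obtain A k where "shape_operator (graph_map f) x A" and A: "\<And>v. A v = k *\<^sub>R v"
    unfolding umbilic_def by blast
  then obtain \<kappa> where "\<kappa> \<noteq> 0" "\<And>v w. fstform x (A v) w = \<kappa> * hess x v w"
    using shape_operator_hess[OF assms] by metis
  moreover have "fstform x (A v) w = k * fstform x v w" for v w
    unfolding A fstform_def by (simp add: algebra_simps)
  ultimately have "hess x v w = k / \<kappa> * fstform x v w" for v w
    by (simp add: field_simps)
  then show "\<exists>k. \<forall>v w. hess x v w = k * fstform x v w" by blast
next
  assume "\<exists>k. \<forall>v w. hess x v w = k * fstform x v w"
  then obtain k where k: "\<And>v w. hess x v w = k * fstform x v w" by blast
  obtain A where A: "shape_operator (graph_map f) x A"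
    using shape_operator_exists[OF assms] .
  then obtain \<kappa> where \<kappa>: "\<And>v w. fstform x (A v) w = \<kappa> * hess x v w"
    using shape_operator_hess[OF assms] by metis
  have "A v = (\<kappa> * k) *\<^sub>R v" for v
  proof -
    have "fstform x (A v - (\<kappa> * k) *\<^sub>R v) w = fstform x (A v) w - \<kappa> * (k * fstform x v w)" for w
      unfolding fstform_def by (simp add: algebra_simps)
    then have "A v - (\<kappa> * k) *\<^sub>R v = 0"
      by (intro fstform_zero[OF assms]) (simp add: \<kappa> k)
    then show ?thesis by simp
  qed
  then show "umbilic (graph_map f) x" unfolding umbilic_def using A by blast
qed

lemma principal_direction_graph_iff:
  assumes "x \<in> S"
  shows "principal_direction (graph_map f) x l \<longleftrightarrow>
    (\<exists>v k. v \<noteq> 0 \<and> (\<forall>w. hess x v w = k * fstform x v w) \<and> l = span {v})"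
proof
  assume "principal_direction (graph_map f) x l"
  then obtain A v k where "shape_operator (graph_map f) x A" and v: "v \<noteq> 0" "l = span {v}"
    and A: "A v = k *\<^sub>R v"
    unfolding principal_direction_def by blast
  then obtain \<kappa> where \<kappa>: "\<kappa> \<noteq> 0" "\<And>v w. fstform x (A v) w = \<kappa> * hess x v w"
    using shape_operator_hess[OF assms] by metis
  have "hess x v w = k / \<kappa> * fstform x v w" for w
    using \<kappa>(1) \<kappa>(2)[of v w] unfolding A fstform_def by (simp add: field_simps)
  then show "\<exists>v k. v \<noteq> 0 \<and> (\<forall>w. hess x v w = k * fstform x v w) \<and> l = span {v}"
    using v by blast
next
  assume "\<exists>v k. v \<noteq> 0 \<and> (\<forall>w. hess x v w = k * fstform x v w) \<and> l = span {v}"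
  then obtain v k where v: "v \<noteq> 0" "l = span {v}"
    and k: "\<And>w. hess x v w = k * fstform x v w" by blast
  obtain A where A: "shape_operator (graph_map f) x A"
    using shape_operator_exists[OF assms] .
  then obtain \<kappa> where \<kappa>: "\<And>v w. fstform x (A v) w = \<kappa> * hess x v w"
    using shape_operator_hess[OF assms] by metis
  have "fstform x (A v - (\<kappa> * k) *\<^sub>R v) w = fstform x (A v) w - \<kappa> * (k * fstform x v w)" for w
    unfolding fstform_def by (simp add: algebra_simps)
  then have "A v - (\<kappa> * k) *\<^sub>R v = 0"
    by (intro fstform_zero[OF assms]) (simp add: \<kappa> k)
  then have "A v = (\<kappa> * k) *\<^sub>R v" by simp
  then show "principal_direction (graph_map f) x l"
    unfolding principal_direction_def using A v by blast
qed

end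

section \<open>Direction fields given by an angle\<close>

text \<open>Lines in the plane are parametrised by twice their angle, so that the
  parameter is well defined modulo \<open>2 * pi\<close>.\<close>

definition dir :: "real \<Rightarrow> (real^2) set" where
  "dir \<beta> = span {unit_vec (\<beta> / 2)}"

lemma unit_vec_component [simp]: "unit_vec t $ 1 = cos t" "unit_vec t $ 2 = sin t"
  by (simp_all add: unit_vec_def)

lemma norm_unit_vec [simp]: "norm (unit_vec t) = 1"
  by (simp add: norm_vec_def L2_set_def sum_2)

lemma unit_vec_nonzero [simp]: "unit_vec t \<noteq> 0"
  using norm_unit_vec[of t] by (metis norm_zero zero_neq_one)

lemma continuous_on_unit_vec:
  fixes h :: "'a::t2_space \<Rightarrow> real"
  assumes "continuous_on A h"
  shows "continuous_on A (\<lambda>x. unit_vec (h x))"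
proof -
  have "unit_vec t = cos t *\<^sub>R axis 1 1 + sin t *\<^sub>R axis 2 1" for t
    by (simp add: vec2_eq_iff axis_def)
  then show ?thesis using assms by (simp add: continuous_intros)
qed

lemma span_scaleR_single:
  fixes v :: "'a::real_vector"
  assumes "k \<noteq> 0"
  shows "span {k *\<^sub>R v} = span {v}"
proof
  show "span {k *\<^sub>R v} \<subseteq> span {v}"
    by (intro span_minimal subspace_span) (simp add: span_base span_scale)
  have "(1 / k) *\<^sub>R k *\<^sub>R v \<in> span {k *\<^sub>R v}"
    by (intro span_scale span_base) simp
  with assms show "span {v} \<subseteq> span {k *\<^sub>R v}"
    by (intro span_minimal subspace_span) simp
qed

lemma cis_double: "cis \<beta> = (cis (\<beta> / 2))\<^sup>2"
  by (simp add: Complex.DeMoivre)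

text \<open>Unit vectors span the same line exactly when they agree up to sign, and squaring
  \<open>cis (\<beta> / 2)\<close> is what forgets the sign.\<close>

lemma dir_eq_iff: "dir \<beta> = dir \<gamma> \<longleftrightarrow> cis \<beta> = cis \<gamma>"
proof
  assume "dir \<beta> = dir \<gamma>"
  then have "unit_vec (\<beta> / 2) \<in> span {unit_vec (\<gamma> / 2)}"
    unfolding dir_def by (metis span_base singletonI)
  then obtain k where k: "unit_vec (\<beta> / 2) = k *\<^sub>R unit_vec (\<gamma> / 2)"
    by (auto simp: span_singleton)
  then have "norm (unit_vec (\<beta> / 2)) = \<bar>k\<bar> * norm (unit_vec (\<gamma> / 2))"
    by (metis norm_scaleR)
  then have "k\<^sup>2 = 1" by (simp add: power2_eq_1_iff abs_if split: if_splits)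
  moreover have "cis (\<beta> / 2) = of_real k * cis (\<gamma> / 2)"
    using k by (simp add: complex_eq_iff vec2_eq_iff)
  ultimately show "cis \<beta> = cis \<gamma>"
    unfolding cis_double[of \<beta>] cis_double[of \<gamma>] by (simp add: power_mult_distrib flip: of_real_power)
next
  assume "cis \<beta> = cis \<gamma>"
  then have "cis (\<beta> / 2) = cis (\<gamma> / 2) \<or> cis (\<beta> / 2) = - cis (\<gamma> / 2)"
    unfolding cis_double[of \<beta>] cis_double[of \<gamma>] by (simp add: power2_eq_iff)
  then obtain e :: real where "e \<noteq> 0" "cis (\<beta> / 2) = of_real e * cis (\<gamma> / 2)"
    using that[of 1] that[of "-1"] by auto
  then have "e \<noteq> 0" "unit_vec (\<beta> / 2) = e *\<^sub>R unit_vec (\<gamma> / 2)"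
    by (simp_all add: complex_eq_iff vec2_eq_iff)
  then show "dir \<beta> = dir \<gamma>"
    unfolding dir_def by (metis span_scaleR_single)
qed

lemma polar_vec2:
  assumes "v \<noteq> 0"
  obtains k t where "k > 0" "t \<in> {0..2*pi}" "v = k *\<^sub>R unit_vec t"
proof -
  let ?z = "Complex (v $ 1) (v $ 2)"
  have "?z \<noteq> 0" using assms by (auto simp: complex_eq_iff vec2_eq_iff)
  then have pos: "cmod ?z > 0" by simp
  have range: "Arg2pi ?z \<in> {0..2*pi}"
    using Arg2pi_ge_0[of ?z] Arg2pi_lt_2pi[of ?z] by simp
  have "?z = of_real (cmod ?z) * exp (\<i> * of_real (Arg2pi ?z))" by (rule Arg2pi_eq)
  then have eq: "v = cmod ?z *\<^sub>R unit_vec (Arg2pi ?z)"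
    by (auto simp: complex_eq_iff vec2_eq_iff Re_exp Im_exp)
  show ?thesis by (rule that[OF pos range eq])
qed

text \<open>Rotating by \<open>- \<gamma>\<close> before taking \<open>Arg\<close> moves the branch
  cut to the ray opposite to \<open>cis \<gamma>\<close>; adding \<gamma> back gives an argument of
  \<open>w\<close> again, modulo \<open>2 * pi\<close>.\<close>

lemma cis_Arg_mult:
  assumes "w \<noteq> 0"
  shows "cis (Arg (w * cis (- \<gamma>)) + \<gamma>) = cis (Arg w)"
proof -
  have "cis (Arg (w * cis (- \<gamma>)) + \<gamma>) = sgn w * (cis (- \<gamma>) * cis \<gamma>)"
    unfolding cis_mult[symmetric, of "Arg _"] using assms by (simp add: cis_Arg sgn_mult mult.assoc)
  also have "cis (- \<gamma>) * cis \<gamma> = 1" by (simp add: cis_mult)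
  finally show ?thesis using assms by (simp add: cis_Arg)
qed

text \<open>\<open>Arg (w x)\<close> may jump by \<open>2 * pi\<close>, which \<open>dir\<close>
  cannot see. For a continuous local generator the cut is turned away from \<open>w x0\<close>: the
  rotated value at \<open>x0\<close> is a positive real, so its \<open>Arg\<close> is continuous
  nearby.\<close>

lemma direction_field_dir:
  assumes "open D" "continuous_on D w" "continuous_on D \<sigma>" "\<And>x. x \<in> D \<Longrightarrow> w x \<noteq> 0"
  shows "direction_field D (\<lambda>x. dir (Arg (w x) + \<sigma> x))"
  unfolding direction_field_def
proof
  fix x0 assume x0: "x0 \<in> D"
  define \<gamma> where "\<gamma> = Arg (w x0)"
  define h where "h x = w x * cis (- \<gamma>)" for x
  define W where "W = D \<inter> h -` (- \<real>\<^sub>\<le>\<^sub>0)"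
  have cont_h: "continuous_on D h"
    unfolding h_def by (intro continuous_intros assms)
  have "open W" unfolding W_def
    by (rule continuous_open_preimage[OF cont_h assms(1)]) auto
  moreover have "h x0 = of_real (cmod (w x0))"
    using rcis_cmod_Arg[of "w x0"] unfolding h_def \<gamma>_def
    by (metis (no_types, lifting) add.right_inverse cis_mult cis_zero mult.assoc mult.right_neutral rcis_def)
  then have "x0 \<in> W"
    using x0 assms(4) unfolding W_def by (simp add: complex_nonpos_Reals_iff)
  moreover have "W \<subseteq> D" unfolding W_def by auto
  moreover have "continuous_on W (\<lambda>x. unit_vec ((Arg (h x) + \<gamma> + \<sigma> x) / 2))"
    using \<open>W \<subseteq> D\<close>
    by (intro continuous_on_unit_vec continuous_intros continuous_on_Arg
        continuous_on_subset[OF cont_h] continuous_on_subset[OF assms(3)]) (auto simp: W_def)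
  moreover have "dir (Arg (w x) + \<sigma> x) = span {unit_vec ((Arg (h x) + \<gamma> + \<sigma> x) / 2)}"
    if "x \<in> W" for x
    using cis_Arg_mult[of "w x" \<gamma>] assms(4)[of x] that \<open>W \<subseteq> D\<close>
    unfolding dir_def[symmetric] dir_eq_iff h_def cis_mult[symmetric]
    by (auto simp flip: cis_mult)
  ultimately show "\<exists>W v. open W \<and> x0 \<in> W \<and> W \<subseteq> D \<and> continuous_on W v \<and>
      (\<forall>q\<in>W. v q \<noteq> 0 \<and> dir (Arg (w q) + \<sigma> q) = span {v q})"
    by (intro exI[of _ W] exI[of _ "\<lambda>x. unit_vec ((Arg (h x) + \<gamma> + \<sigma> x) / 2)"])
      (simp only: unit_vec_nonzero, simp)
qed

text \<open>The hypothesis \<open>slit\<close> takes the place of winding number theory: along the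
  circle, \<open>w\<close> never points opposite to the rotating direction of angle
  \<open>\<beta> + of_int n * t\<close>, so this angle plus the principal argument of the quotient
  is a continuous argument of \<open>w\<close>. The quotient and \<sigma> have equal values at
  \<open>t = 0\<close> and \<open>t = 2 * pi\<close>, so only the linear part contributes, and
  halving the doubled angle gives \<open>of_int n / 2\<close>.\<close>

lemma has_index_dir:
  fixes n :: int
  assumes "\<epsilon> > 0"
    and cw: "continuous_on (ball 0 \<epsilon> - {0}) w" and c\<sigma>: "continuous_on (ball 0 \<epsilon> - {0}) \<sigma>"
    and slit: "\<And>r t. 0 < r \<Longrightarrow> r < \<epsilon> \<Longrightarrow> t \<in> {0..2*pi} \<Longrightarrow>
      w (r *\<^sub>R unit_vec t) * cis (- (\<beta> + of_int n * t)) \<notin> \<real>\<^sub>\<le>\<^sub>0"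
  shows "has_index_at_origin (\<lambda>x. dir (Arg (w x) + \<sigma> x)) (of_int n / 2)"
  unfolding has_index_at_origin_def
proof (intro exI[of _ \<epsilon>] conjI allI impI assms(1))
  fix r :: real assume r: "0 < r \<and> r < \<epsilon>"
  define h where "h t = w (r *\<^sub>R unit_vec t) * cis (- (\<beta> + of_int n * t))" for t
  define \<theta> where "\<theta> t = (Arg (h t) + (\<beta> + of_int n * t) + \<sigma> (r *\<^sub>R unit_vec t)) / 2" for t
  have sub: "(\<lambda>t. r *\<^sub>R unit_vec t) ` {0..2*pi} \<subseteq> ball 0 \<epsilon> - {0}"
    using r by auto
  have cu: "continuous_on {0..2*pi} (\<lambda>t. r *\<^sub>R unit_vec t)"
    by (intro continuous_intros continuous_on_unit_vec)
  note c = continuous_on_compose2[OF _ cu sub]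
  have "continuous_on {0..2*pi} h"
    unfolding h_def by (intro continuous_intros c[OF cw])
  then have "continuous_on {0..2*pi} \<theta>"
    unfolding \<theta>_def using slit r
    by (intro continuous_intros continuous_on_Arg c[OF c\<sigma>]) (auto simp: h_def)
  moreover have "dir (Arg (w (r *\<^sub>R unit_vec t)) + \<sigma> (r *\<^sub>R unit_vec t)) = span {unit_vec (\<theta> t)}"
    if "t \<in> {0..2*pi}" for t
  proof -
    have "h t \<noteq> 0" using slit[of r t] r that unfolding h_def by auto
    then have "w (r *\<^sub>R unit_vec t) \<noteq> 0" unfolding h_def by auto
    then have "cis (Arg (h t) + (\<beta> + of_int n * t)) = cis (Arg (w (r *\<^sub>R unit_vec t)))"
      unfolding h_def by (rule cis_Arg_mult)
    then show ?thesis
      unfolding \<theta>_def dir_def[symmetric] dir_eq_iff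
      by (metis cis_mult)
  qed
  moreover have "(\<theta> (2*pi) - \<theta> 0) / (2*pi) = of_int n / 2"
  proof -
    have "unit_vec (2*pi) = unit_vec 0" by (simp add: unit_vec_def)
    moreover have "cis (- (\<beta> + of_int n * (2*pi))) = cis (- \<beta>)"
      using cis_multiple_2pi[of "of_int n"] by (simp add: mult_ac flip: cis_divide)
    ultimately have "h (2*pi) = h 0" unfolding h_def by simp
    then have "\<theta> (2*pi) - \<theta> 0 = of_int n * pi"
      unfolding \<theta>_def using \<open>unit_vec (2*pi) = unit_vec 0\<close> by (simp add: field_simps)
    then show ?thesis by simp
  qed
  ultimately show "\<exists>\<theta>. continuous_on {0..2*pi} \<theta> \<and>
      (\<forall>t\<in>{0..2*pi}. dir (Arg (w (r *\<^sub>R unit_vec t)) + \<sigma> (r *\<^sub>R unit_vec t)) = span {unit_vec (\<theta> t)}) \<and>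
      (\<theta> (2*pi) - \<theta> 0) / (2*pi) = of_int n / 2"
    by blast
qed

section \<open>Curvature line flows of a graph\<close>

context lorentz_graph
begin

text \<open>In terms of twice the angle \<open>\<beta>\<close>, a direction \<open>v\<close> is principal iff
  \<open>fstform x v\<close> and \<open>hess x v\<close> are parallel, that is, iff
  \<open>offset x + Im (wdir x * cis (- \<beta>)) = 0\<close>. The offset accounts for the principal
  directions not being orthogonal in the parameter plane.\<close>

definition offset :: "real^2 \<Rightarrow> real" where
  "offset x = b x * ((q x)\<^sup>2 - (p x)\<^sup>2) - p x * q x * (c x - a x)"

definition wdir :: "real^2 \<Rightarrow> complex" where
  "wdir x = Complex (a x - c x + (p x)\<^sup>2 * c x - (q x)\<^sup>2 * a x)
     (2 * b x - b x * ((p x)\<^sup>2 + (q x)\<^sup>2) + p x * q x * (a x + c x))"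

text \<open>\<open>fstform x v\<close> and \<open>hess x v\<close> are linear functionals of
  \<open>w\<close>, the first nonzero by positivity, so being parallel is the vanishing of a 2 by 2
  determinant. This determinant is quadratic in \<open>v\<close>, hence a constant plus a pure first
  harmonic in the doubled angle \<beta>.\<close>

lemma parallel_iff:
  assumes "x \<in> S" "k \<noteq> 0" "v = k *\<^sub>R unit_vec (\<beta> / 2)"
  shows "(\<exists>k. \<forall>w. hess x v w = k * fstform x v w) \<longleftrightarrow> offset x + Im (wdir x * cis (- \<beta>)) = 0"
proof -
  define i1 i2 h1 h2 where "i1 = v $ 1 - p x * (p x * v $ 1 + q x * v $ 2)"
    and "i2 = v $ 2 - q x * (p x * v $ 1 + q x * v $ 2)"
    and "h1 = a x * v $ 1 + b x * v $ 2" and "h2 = b x * v $ 1 + c x * v $ 2"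
  have I: "fstform x v w = i1 * w $ 1 + i2 * w $ 2"
    and H: "hess x v w = h1 * w $ 1 + h2 * w $ 2" for w
    unfolding fstform_def hess_def i1_def i2_def h1_def h2_def by (simp_all add: algebra_simps)
  have "v \<noteq> 0" using assms(2,3) by simp
  then have nz: "i1 \<noteq> 0 \<or> i2 \<noteq> 0"
    using fstform_pos[OF assms(1), of v] unfolding I by auto
  have "(\<exists>k. \<forall>w. hess x v w = k * fstform x v w) \<longleftrightarrow> (\<exists>k. h1 = k * i1 \<and> h2 = k * i2)"
  proof
    assume "\<exists>k. \<forall>w. hess x v w = k * fstform x v w"
    then obtain k where "\<And>w :: real^2. h1 * w $ 1 + h2 * w $ 2 = k * (i1 * w $ 1 + i2 * w $ 2)"
      unfolding I H by blast
    from this[of "vector [1, 0]"] this[of "vector [0, 1]"]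
    show "\<exists>k. h1 = k * i1 \<and> h2 = k * i2" by auto
  next
    assume "\<exists>k. h1 = k * i1 \<and> h2 = k * i2"
    then show "\<exists>k. \<forall>w. hess x v w = k * fstform x v w"
      unfolding I H by (auto simp: algebra_simps)
  qed
  also have "\<dots> \<longleftrightarrow> i1 * h2 - i2 * h1 = 0"
  proof
    assume *: "i1 * h2 - i2 * h1 = 0"
    show "\<exists>k. h1 = k * i1 \<and> h2 = k * i2"
    proof (cases "i1 = 0")
      case True
      with * nz show ?thesis by (intro exI[of _ "h2 / i2"]) auto
    next
      case False
      with * show ?thesis by (intro exI[of _ "h1 / i1"]) (auto simp: field_simps)
    qed
  qed auto
  also have "2 * (i1 * h2 - i2 * h1) = k\<^sup>2 * (offset x + Im (wdir x * cis (- \<beta>)))"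
  proof -
    define C D where "C = cos (\<beta> / 2)" and "D = sin (\<beta> / 2)"
    have v: "v $ 1 = k * C" "v $ 2 = k * D" using assms(3) by (simp_all add: C_def D_def)
    have "cos \<beta> = C\<^sup>2 - D\<^sup>2" "sin \<beta> = 2 * D * C"
      using cos_double[of "\<beta> / 2"] sin_double[of "\<beta> / 2"] by (simp_all add: C_def D_def)
    moreover have "C\<^sup>2 + D\<^sup>2 = 1" by (simp add: C_def D_def)
    ultimately show ?thesis
      unfolding offset_def wdir_def i1_def i2_def h1_def h2_def v by simp algebra
  qed
  then have "i1 * h2 - i2 * h1 = 0 \<longleftrightarrow> offset x + Im (wdir x * cis (- \<beta>)) = 0"
    using assms(2) by (metis mult_eq_0_iff power2_eq_square zero_neq_numeral)
  finally show ?thesis .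
qed

text \<open>The equation of principal directions reads
  \<open>sin (\<beta> - Arg (wdir x)) = offset x / cmod (wdir x)\<close>, and \<open>tilt x\<close>
  and \<open>pi - tilt x\<close> are the two solutions for the difference. With
  \<open>offset x = 0\<close> they would be perpendicular lines, since \<beta> is a doubled
  angle.\<close>

definition tilt :: "real^2 \<Rightarrow> real" where
  "tilt x = arcsin (offset x / cmod (wdir x))"

definition flow1 :: "real^2 \<Rightarrow> (real^2) set" where
  "flow1 x = dir (Arg (wdir x) + tilt x)"

definition flow2 :: "real^2 \<Rightarrow> (real^2) set" where
  "flow2 x = dir (Arg (wdir x) + (pi - tilt x))"

text \<open>Strictness of the bound gives \<open>tilt x\<close> a positive cosine. The two solutions
  of the sine equation differ in the sign of the cosine, so they stay distinct.\<close>

lemma angle_equation: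
  assumes "\<bar>offset x\<bar> < cmod (wdir x)"
  shows "offset x + Im (wdir x * cis (- \<beta>)) = 0 \<longleftrightarrow> dir \<beta> = flow1 x \<or> dir \<beta> = flow2 x"
    and "flow1 x \<noteq> flow2 x"
proof -
  define A s where "A = Arg (wdir x)" and "s = tilt x"
  have pos: "cmod (wdir x) > 0" using assms by linarith
  have "\<bar>offset x / cmod (wdir x)\<bar> < 1" using assms pos by (simp add: abs_divide)
  then have bound: "- 1 < offset x / cmod (wdir x)" "offset x / cmod (wdir x) < 1"
    unfolding abs_less_iff by linarith+
  have s: "sin s = offset x / cmod (wdir x)"
    unfolding s_def tilt_def using bound by (intro sin_arcsin) linarith+
  have "- (pi / 2) < s" "s < pi / 2"
    unfolding s_def tilt_def using arcsin_lt_bounded[OF bound] by auto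
  then have cos_s: "cos s > 0" by (intro cos_gt_zero_pi) auto
  have "wdir x * cis (- \<beta>) = rcis (cmod (wdir x)) (A - \<beta>)"
    using rcis_cmod_Arg[of "wdir x"] unfolding A_def
    by (metis cis_rcis_eq mult.right_neutral rcis_mult add_uminus_conv_diff)
  then have "offset x + Im (wdir x * cis (- \<beta>)) = cmod (wdir x) * (sin s - sin (\<beta> - A))"
    using s pos by (simp add: field_simps sin_diff)
  then have "offset x + Im (wdir x * cis (- \<beta>)) = 0 \<longleftrightarrow> sin (\<beta> - A) = sin s"
    using pos by auto
  also have "\<dots> \<longleftrightarrow> cis (\<beta> - A) = cis s \<or> cis (\<beta> - A) = cis (pi - s)"
  proof
    assume eq: "sin (\<beta> - A) = sin s"
    then have "(cos (\<beta> - A))\<^sup>2 = (cos s)\<^sup>2" by (simp add: cos_squared_eq)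
    then show "cis (\<beta> - A) = cis s \<or> cis (\<beta> - A) = cis (pi - s)"
      using eq by (auto simp: complex_eq_iff power2_eq_iff)
  qed (auto simp: complex_eq_iff)
  also have "\<dots> \<longleftrightarrow> cis \<beta> = cis (A + s) \<or> cis \<beta> = cis (A + (pi - s))"
  proof -
    have "cis (\<beta> - A) = cis u \<longleftrightarrow> cis \<beta> = cis (A + u)" for u
      by (simp add: field_simps flip: cis_mult cis_divide)
    then show ?thesis by blast
  qed
  finally show "offset x + Im (wdir x * cis (- \<beta>)) = 0 \<longleftrightarrow> dir \<beta> = flow1 x \<or> dir \<beta> = flow2 x"
    unfolding flow1_def flow2_def dir_eq_iff A_def s_def .
  have "cis s \<noteq> cis (pi - s)" using cos_s by (simp add: complex_eq_iff)
  then show "flow1 x \<noteq> flow2 x"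
    unfolding flow1_def flow2_def dir_eq_iff A_def[symmetric] s_def[symmetric]
    by (simp flip: cis_mult)
qed

lemma not_umbilic:
  assumes "x \<in> S" "\<bar>offset x\<bar> < cmod (wdir x)"
  shows "\<not> umbilic (graph_map f) x"
proof
  assume "umbilic (graph_map f) x"
  then have "offset x + Im (wdir x * cis (- \<beta>)) = 0" for \<beta>
    using parallel_iff[OF assms(1), of 1 _ \<beta>] umbilic_graph_iff[OF assms(1)] by auto
  \<comment> \<open>At an umbilic all directions are principal. The angles 0 and \<open>pi\<close>
    annihilate the offset and the imaginary part, and \<open>pi / 2\<close> then the real
    part.\<close>
  from this[of 0] this[of pi] this[of "pi / 2"] have "wdir x = 0"
    by (auto simp: complex_eq_iff)
  then show False using assms(2) by simp
qed

lemma principal_directions: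
  assumes "x \<in> S" "\<bar>offset x\<bar> < cmod (wdir x)"
  shows "{l. principal_direction (graph_map f) x l} = {flow1 x, flow2 x}"
proof -
  have "principal_direction (graph_map f) x l \<longleftrightarrow>
      (\<exists>\<beta>. offset x + Im (wdir x * cis (- \<beta>)) = 0 \<and> l = dir \<beta>)" for l
  proof
    assume "principal_direction (graph_map f) x l"
    then obtain v k where v: "v \<noteq> 0" "\<forall>w. hess x v w = k * fstform x v w" "l = span {v}"
      unfolding principal_direction_graph_iff[OF assms(1)] by blast
    obtain r t where "r > 0" "v = r *\<^sub>R unit_vec t"
      using polar_vec2[OF v(1)] .
    then obtain \<beta> where r: "r > 0" "v = r *\<^sub>R unit_vec (\<beta> / 2)"
      using that[of "2 * t"] by simp
    then have "l = dir \<beta>" using v(3) by (simp add: dir_def span_scaleR_single)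
    moreover have "offset x + Im (wdir x * cis (- \<beta>)) = 0"
      using parallel_iff[OF assms(1) _ r(2)] r(1) v(2) by auto
    ultimately show "\<exists>\<beta>. offset x + Im (wdir x * cis (- \<beta>)) = 0 \<and> l = dir \<beta>" by blast
  next
    assume "\<exists>\<beta>. offset x + Im (wdir x * cis (- \<beta>)) = 0 \<and> l = dir \<beta>"
    then obtain \<beta> where \<beta>: "offset x + Im (wdir x * cis (- \<beta>)) = 0" "l = dir \<beta>" by blast
    then obtain k where "\<forall>w. hess x (unit_vec (\<beta> / 2)) w = k * fstform x (unit_vec (\<beta> / 2)) w"
      using parallel_iff[OF assms(1), of 1 _ \<beta>] by auto
    then show "principal_direction (graph_map f) x l"
      unfolding principal_direction_graph_iff[OF assms(1)]
      using \<beta>(2) unit_vec_nonzero unfolding dir_def by blast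
  qed
  moreover have "\<exists>\<beta>. flow1 x = dir \<beta>" "\<exists>\<beta>. flow2 x = dir \<beta>"
    unfolding flow1_def flow2_def by blast+
  ultimately show ?thesis
    using angle_equation(1)[OF assms(2)] by (auto; metis)
qed

lemma continuous_data:
  assumes "continuous_on S a" "continuous_on S b" "continuous_on S c"
  shows "continuous_on S offset" "continuous_on S wdir"
proof -
  have "continuous_on S p" "continuous_on S q"
    using deriv_p deriv_q
    by (meson continuous_at_imp_continuous_on has_derivative_continuous)+
  with assms show "continuous_on S offset" "continuous_on S wdir"
    unfolding offset_def wdir_def Complex_eq
    by (auto intro!: continuous_intros)
qed

lemma continuous_tilt:
  assumes "continuous_on S a" "continuous_on S b" "continuous_on S c"
    and "\<And>x. x \<in> S \<Longrightarrow> \<bar>offset x\<bar> < cmod (wdir x)"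
  shows "continuous_on S tilt"
proof -
  have nz: "wdir x \<noteq> 0" if "x \<in> S" for x
    using assms(4)[OF that] by auto
  have "\<bar>offset x / cmod (wdir x)\<bar> \<le> 1" if "x \<in> S" for x
    using assms(4)[OF that] by (auto simp: abs_divide divide_le_eq_1)
  then have "- 1 \<le> offset x / cmod (wdir x) \<and> offset x / cmod (wdir x) \<le> 1" if "x \<in> S" for x
    using that unfolding abs_le_iff by (metis minus_le_iff)
  with nz show ?thesis
    unfolding tilt_def[abs_def]
    by (intro continuous_on_arcsin continuous_intros continuous_data assms(1-3)) auto
qed

lemma curvature_line_flows_graph:
  assumes "continuous_on S a" "continuous_on S b" "continuous_on S c"
    and "\<And>x. x \<in> S \<Longrightarrow> \<bar>offset x\<bar> < cmod (wdir x)"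
  shows "curvature_line_flows (graph_map f) S flow1 flow2"
proof -
  have "wdir x \<noteq> 0" if "x \<in> S" for x using assms(4)[OF that] by auto
  then show ?thesis
    unfolding curvature_line_flows_def flow1_def[abs_def] flow2_def[abs_def]
    using assms angle_equation(2)[unfolded flow1_def flow2_def]
      principal_directions[unfolded flow1_def flow2_def]
    by (intro conjI direction_field_dir open_S continuous_data continuous_tilt
        continuous_on_diff continuous_on_const) auto
qed

end

section \<open>Homogeneous graphs\<close>

definition homogeneous :: "real \<Rightarrow> (real^2 \<Rightarrow> real) \<Rightarrow> bool" where
  "homogeneous d h \<longleftrightarrow> (\<forall>r>0. \<forall>x. h (r *\<^sub>R x) = r powr d * h x)"

text \<open>Differentiate \<open>f (r *\<^sub>R y) = r powr d * f y\<close> in \<open>y\<close> and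
  divide by \<open>r\<close>. At the origin the value is set to 0, which is compatible with every
  degree.\<close>

lemma homogeneous_gradient:
  assumes hom: "homogeneous d f"
    and deriv: "\<And>x. x \<noteq> 0 \<Longrightarrow> (f has_derivative (\<lambda>v. p x * v $ 1 + q x * v $ 2)) (at x)"
    and "p 0 = 0" "q 0 = 0"
  shows "homogeneous (d - 1) p" "homogeneous (d - 1) q"
proof -
  have "p (r *\<^sub>R x) = r powr (d - 1) * p x \<and> q (r *\<^sub>R x) = r powr (d - 1) * q x"
    if r: "r > 0" for r x
  proof (cases "x = 0")
    case False
    have "((\<lambda>y. f (r *\<^sub>R y)) has_derivative
        (\<lambda>v. p (r *\<^sub>R x) * (r *\<^sub>R v) $ 1 + q (r *\<^sub>R x) * (r *\<^sub>R v) $ 2)) (at x)"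
      using has_derivative_compose[OF bounded_linear_imp_has_derivative[OF bounded_linear_scaleR_right]
          deriv[of "r *\<^sub>R x"]] r False by simp
    moreover have "((\<lambda>y. f (r *\<^sub>R y)) has_derivative
        (\<lambda>v. r powr d * (p x * v $ 1 + q x * v $ 2))) (at x)"
      using has_derivative_mult_right[OF deriv[OF False], of "r powr d"] hom r
      unfolding homogeneous_def by simp
    ultimately have "(\<lambda>v :: real^2. p (r *\<^sub>R x) * (r *\<^sub>R v) $ 1 + q (r *\<^sub>R x) * (r *\<^sub>R v) $ 2)
        = (\<lambda>v. r powr d * (p x * v $ 1 + q x * v $ 2))"
      by (rule has_derivative_unique)
    from fun_cong[OF this] have "p (r *\<^sub>R x) * (r * v $ 1) + q (r *\<^sub>R x) * (r * v $ 2)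
        = r powr d * (p x * v $ 1 + q x * v $ 2)" for v :: "real^2"
      by simp
    from this[of "vector [1, 0]"] this[of "vector [0, 1]"] show ?thesis
      using r by (simp add: powr_diff field_simps)
  qed (use assms in auto)
  then show "homogeneous (d - 1) p" "homogeneous (d - 1) q"
    unfolding homogeneous_def by auto
qed

lemma homogeneous_bound:
  assumes "homogeneous d h" "continuous_on (- {0}) h" "h 0 = 0"
  obtains C where "\<And>x. \<bar>h x\<bar> \<le> C * norm x powr d"
proof -
  have "compact (h ` sphere 0 1)"
    by (intro compact_continuous_image continuous_on_subset[OF assms(2)] compact_sphere) auto
  then have "bounded (h ` sphere 0 1)" by (rule compact_imp_bounded)
  then obtain C where "\<forall>y \<in> h ` sphere 0 1. norm y \<le> C"
    unfolding bounded_iff by blast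
  then have C: "\<bar>h u\<bar> \<le> C" if "norm u = 1" for u
    using that by auto
  have "\<bar>h x\<bar> \<le> C * norm x powr d" for x
  proof (cases "x = 0")
    case False
    then have "h x = norm x powr d * h ((1 / norm x) *\<^sub>R x)"
      using assms(1)[unfolded homogeneous_def, rule_format, of "norm x" "(1 / norm x) *\<^sub>R x"] by simp
    then have "\<bar>h x\<bar> = norm x powr d * \<bar>h ((1 / norm x) *\<^sub>R x)\<bar>"
      by (simp add: abs_mult)
    also have "\<dots> \<le> norm x powr d * C"
      using False by (intro mult_left_mono C) auto
    finally show ?thesis by (simp add: mult.commute)
  qed (use assms in simp)
  then show ?thesis using that by blast
qed

lemma homogeneous_isCont_0:
  assumes "homogeneous d h" "continuous_on (- {0}) h" "h 0 = 0" "d > 0"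
  shows "isCont h 0"
proof -
  obtain C where C: "\<And>x. \<bar>h x\<bar> \<le> C * norm x powr d"
    using homogeneous_bound[OF assms(1-3)] by blast
  have "((\<lambda>x :: real^2. C * norm x powr d) \<longlongrightarrow> C * 0 powr d) (at 0)"
    by (rule tendsto_intros tendsto_powr2 tendsto_norm_zero | use assms in simp)+
  then have "((\<lambda>x :: real^2. C * norm x powr d) \<longlongrightarrow> 0) (at 0)" by simp
  then have "(h \<longlongrightarrow> 0) (at 0)"
    by (rule Lim_null_comparison[rotated]) (use C in auto)
  then show ?thesis using assms(3) by (simp add: isCont_def)
qed

lemma homogeneous_has_derivative_0:
  assumes "homogeneous d h" "continuous_on (- {0}) h" "h 0 = 0" "d > 1"
  shows "(h has_derivative (\<lambda>v. 0)) (at 0)"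
proof -
  obtain C where C: "\<And>x. \<bar>h x\<bar> \<le> C * norm x powr d"
    using homogeneous_bound[OF assms(1-3)] by blast
  have "((\<lambda>x :: real^2. C * norm x powr (d - 1)) \<longlongrightarrow> C * 0 powr (d - 1)) (at 0)"
    by (rule tendsto_intros tendsto_powr2 tendsto_norm_zero | use assms in simp)+
  then have lim: "((\<lambda>x :: real^2. C * norm x powr (d - 1)) \<longlongrightarrow> 0) (at 0)" by simp
  have "norm (h x / norm x) \<le> C * norm x powr (d - 1)" if "x \<noteq> 0" for x
    using C[of x] that by (simp add: powr_diff field_simps)
  then have "((\<lambda>x. h x / norm x) \<longlongrightarrow> 0) (at 0)"
    by (intro Lim_null_comparison[OF _ lim]) (auto simp: eventually_at_filter)
  then have "((\<lambda>x. \<bar>h x / norm x\<bar>) \<longlongrightarrow> 0) (at 0)"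
    by (rule tendsto_rabs_zero)
  then show ?thesis using assms(3) by (simp add: has_derivative_at)
qed

text \<open>A function with its derivatives up to order two away from the origin. For
  \<open>1 < d < 2\<close> the second derivatives may be unbounded near the origin, and their value
  0 there is a convention that keeps \<open>homogeneous\<close> true; for \<open>d > 2\<close> it is
  the true derivative.\<close>

locale homogeneous_jet =
  fixes d :: real and f p q a b c :: "real^2 \<Rightarrow> real"
  assumes smooth: "smooth_on (- {0}) f"
    and homogeneous_f: "homogeneous d f"
    and deriv_f: "\<And>x. x \<noteq> 0 \<Longrightarrow> (f has_derivative (\<lambda>v. p x * v $ 1 + q x * v $ 2)) (at x)"
    and deriv_p: "\<And>x. x \<noteq> 0 \<Longrightarrow> (p has_derivative (\<lambda>v. a x * v $ 1 + b x * v $ 2)) (at x)"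
    and deriv_q: "\<And>x. x \<noteq> 0 \<Longrightarrow> (q has_derivative (\<lambda>v. b x * v $ 1 + c x * v $ 2)) (at x)"
    and cont: "continuous_on (- {0}) a" "continuous_on (- {0}) b" "continuous_on (- {0}) c"
    and zero: "f 0 = 0" "p 0 = 0" "q 0 = 0" "a 0 = 0" "b 0 = 0" "c 0 = 0"
begin

lemma homogeneous_pq: "homogeneous (d - 1) p" "homogeneous (d - 1) q"
  using homogeneous_gradient[OF homogeneous_f deriv_f] zero by auto

lemma homogeneous_abc: "homogeneous (d - 2) a" "homogeneous (d - 2) b" "homogeneous (d - 2) c"
  using homogeneous_gradient[OF homogeneous_pq(1) deriv_p] homogeneous_gradient[OF homogeneous_pq(2) deriv_q]
    zero by auto

lemma cont_fpq: "continuous_on (- {0}) f" "continuous_on (- {0}) p" "continuous_on (- {0}) q"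
  by (auto intro!: continuous_at_imp_continuous_on has_derivative_continuous[OF deriv_f]
      has_derivative_continuous[OF deriv_p] has_derivative_continuous[OF deriv_q])

text \<open>By compactness, the rotated Hessian curve on the unit circle keeps a positive distance
  from the slit. On the circle of radius \<open>r\<close>, up to the positive factor
  \<open>r powr (d - 2)\<close>, \<open>wdir\<close> differs from it by a bounded function times
  \<open>r powr (2 * (d - 1))\<close>, and \<open>offset\<close> has that size too. As
  \<open>d > 1\<close>, for small \<open>r\<close> the slit is still avoided and
  \<open>offset\<close> is too small to merge the two principal directions.\<close>

lemma flows_exist:
  fixes n :: int
  assumes d: "d > 1"
    and slit: "\<And>t. Complex (a (unit_vec t) - c (unit_vec t)) (2 * b (unit_vec t))
        * cis (- (\<beta> + of_int n * t)) \<notin> \<real>\<^sub>\<le>\<^sub>0"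
  obtains \<epsilon> where "\<epsilon> > 0" "lorentz_graph (ball 0 \<epsilon> - {0}) f p q a b c"
    "\<And>x. x \<in> ball 0 \<epsilon> - {0} \<Longrightarrow> \<not> umbilic (graph_map f) x"
    "\<exists>L1 L2. curvature_line_flows (graph_map f) (ball 0 \<epsilon> - {0}) L1 L2 \<and>
       has_index_at_origin L1 (of_int n / 2) \<and> has_index_at_origin L2 (of_int n / 2)"
proof -
  define W0 W1 P where
    "W0 u = Complex (a u - c u) (2 * b u)" and
    "W1 u = Complex ((p u)\<^sup>2 * c u - (q u)\<^sup>2 * a u)
       (p u * q u * (a u + c u) - b u * ((p u)\<^sup>2 + (q u)\<^sup>2))" and
    "P u = b u * ((q u)\<^sup>2 - (p u)\<^sup>2) - p u * q u * (c u - a u)" for u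
  define H where "H t = W0 (unit_vec t) * cis (- (\<beta> + of_int n * t))" for t
  define B where "B u = cmod (W1 u) + \<bar>P u\<bar> + ((p u)\<^sup>2 + (q u)\<^sup>2)" for u
  let ?I = "{0..2*pi}"
  have cu: "continuous_on ?I unit_vec" by (intro continuous_on_unit_vec continuous_on_id)
  have ne: "unit_vec ` ?I \<subseteq> - {0}"
    using unit_vec_nonzero by force
  have "continuous_on (- {0}) W0" unfolding W0_def[abs_def] Complex_eq
    by (intro continuous_intros cont)
  from continuous_on_compose2[OF this cu ne] have "continuous_on ?I H"
    unfolding H_def by (intro continuous_intros)
  then have "compact (H ` ?I)" by (intro compact_continuous_image) auto
  moreover have "H ` ?I \<inter> \<real>\<^sub>\<le>\<^sub>0 = {}" using slit unfolding H_def W0_def by auto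
  ultimately obtain \<delta> where \<delta>: "\<delta> > 0"
    "\<And>t y. t \<in> ?I \<Longrightarrow> y \<in> \<real>\<^sub>\<le>\<^sub>0 \<Longrightarrow> \<delta> \<le> dist (H t) y"
    using separate_compact_closed[of "H ` ?I" "\<real>\<^sub>\<le>\<^sub>0"] by (auto simp: closed_nonpos_Reals_complex)
  have "continuous_on (- {0}) B" unfolding B_def[abs_def] W1_def P_def Complex_eq
    by (intro continuous_intros cont cont_fpq)
  from continuous_on_compose2[OF this cu ne] have "continuous_on ?I (\<lambda>t. B (unit_vec t))" .
  then have "compact ((\<lambda>t. B (unit_vec t)) ` ?I)" by (intro compact_continuous_image) auto
  then have "bounded ((\<lambda>t. B (unit_vec t)) ` ?I)" by (rule compact_imp_bounded)
  then obtain M where "\<forall>y \<in> (\<lambda>t. B (unit_vec t)) ` ?I. norm y \<le> M"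
    unfolding bounded_iff by blast
  then have "\<bar>B (unit_vec t)\<bar> \<le> M" if "t \<in> ?I" for t
    using that unfolding real_norm_def by blast
  then have M: "B (unit_vec t) \<le> M" if "t \<in> ?I" for t
    using that abs_le_D1 by blast
  have "B (unit_vec 0) \<ge> 0" unfolding B_def by simp
  then have M0: "M \<ge> 0" using M[of 0] by simp
  \<comment> \<open>The bound \<open>\<delta> / 2\<close> serves the directions, and 1 serves the
    gradient condition; \<open>M + 1\<close> avoids dividing by 0. Then \<epsilon> is chosen to
    solve \<open>\<epsilon> powr (2 * (d - 1)) = \<eta>\<close>.\<close>
  define \<eta> where "\<eta> = min (\<delta> / 2) 1 / (M + 1)"
  define \<epsilon> where "\<epsilon> = \<eta> powr (1 / (2 * (d - 1)))"
  have \<eta>: "\<eta> > 0" using \<delta>(1) M0 unfolding \<eta>_def by simp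
  then have \<epsilon>: "\<epsilon> > 0" unfolding \<epsilon>_def by simp
  define \<rho> where "\<rho> r = r powr (2 * (d - 1))" for r
  have \<rho>: "\<rho> r \<ge> 0" "\<rho> r * M < min (\<delta> / 2) 1" if "0 < r" "r < \<epsilon>" for r
  proof -
    have "\<rho> r < \<epsilon> powr (2 * (d - 1))"
      unfolding \<rho>_def using that d by (intro powr_less_mono2) auto
    also have "\<dots> = \<eta>" unfolding \<epsilon>_def using d \<eta> by (simp add: powr_powr)
    finally have "\<rho> r * (M + 1) < min (\<delta> / 2) 1"
      using M0 unfolding \<eta>_def by (simp add: pos_less_divide_eq)
    moreover show "\<rho> r \<ge> 0" unfolding \<rho>_def by simp
    ultimately show "\<rho> r * M < min (\<delta> / 2) 1" by (simp add: distrib_left)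
  qed
  have hom: "p (r *\<^sub>R u) = r powr (d - 1) * p u" "q (r *\<^sub>R u) = r powr (d - 1) * q u"
    "a (r *\<^sub>R u) = r powr (d - 2) * a u" "b (r *\<^sub>R u) = r powr (d - 2) * b u"
    "c (r *\<^sub>R u) = r powr (d - 2) * c u" if "r > 0" for r u
    using homogeneous_pq homogeneous_abc that unfolding homogeneous_def by auto
  have sq: "(r powr (d - 1))\<^sup>2 = \<rho> r" for r
    unfolding \<rho>_def by (simp add: power2_eq_square flip: powr_add)
  have grad: "(p x)\<^sup>2 + (q x)\<^sup>2 < 1" if x: "x \<in> ball 0 \<epsilon> - {0}" for x
  proof -
    obtain r t where r: "r > 0" "t \<in> ?I" "x = r *\<^sub>R unit_vec t"
      using polar_vec2[of x] x by auto
    then have "r < \<epsilon>" using x by simp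
    have "(p x)\<^sup>2 + (q x)\<^sup>2 = \<rho> r * ((p (unit_vec t))\<^sup>2 + (q (unit_vec t))\<^sup>2)"
      unfolding r(3) hom[OF r(1)] by (simp add: power_mult_distrib sq algebra_simps)
    also have "\<dots> \<le> \<rho> r * M"
    proof (intro mult_left_mono \<rho>)
      have "(p (unit_vec t))\<^sup>2 + (q (unit_vec t))\<^sup>2 \<le> B (unit_vec t)" unfolding B_def by simp
      then show "(p (unit_vec t))\<^sup>2 + (q (unit_vec t))\<^sup>2 \<le> M" using M[OF r(2)] by linarith
    qed (use r \<open>r < \<epsilon>\<close> in auto)
    finally show ?thesis using \<rho>(2)[OF r(1) \<open>r < \<epsilon>\<close>] by linarith
  qed
  interpret g: lorentz_graph "ball 0 \<epsilon> - {0}" f p q a b c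
    by unfold_locales (use deriv_f deriv_p deriv_q grad smooth_on_subset[OF smooth] in auto)
  \<comment> \<open>Every correction term is a product of one second derivative and two first
    derivatives, so it scales exactly by \<open>r powr (d - 2) * \<rho> r\<close>.\<close>
  have polar: "g.wdir (r *\<^sub>R u) = of_real (r powr (d - 2)) * (W0 u + of_real (\<rho> r) * W1 u)"
    "g.offset (r *\<^sub>R u) = r powr (d - 2) * (\<rho> r * P u)" if "r > 0" for r u
    unfolding g.wdir_def g.offset_def W0_def W1_def P_def hom[OF that] sq[symmetric]
    by (simp_all add: complex_eq_iff power2_eq_square algebra_simps)
  have est: "g.wdir (r *\<^sub>R unit_vec t) * cis (- (\<beta> + of_int n * t)) \<notin> \<real>\<^sub>\<le>\<^sub>0 \<and>
      \<bar>g.offset (r *\<^sub>R unit_vec t)\<bar> < cmod (g.wdir (r *\<^sub>R unit_vec t))"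
    if r: "0 < r" "r < \<epsilon>" and t: "t \<in> ?I" for r t
  proof -
    let ?u = "unit_vec t" and ?s = "r powr (d - 2)"
    define y where "y = (W0 ?u + of_real (\<rho> r) * W1 ?u) * cis (- (\<beta> + of_int n * t))"
    have s: "?s > 0" using r by simp
    have "cmod (W1 ?u) \<le> M" "\<bar>P ?u\<bar> \<le> M" using M[OF t] unfolding B_def
      by (smt (verit) norm_ge_zero zero_le_power2)+
    then have small: "\<rho> r * cmod (W1 ?u) < \<delta> / 2" "\<rho> r * \<bar>P ?u\<bar> < \<delta> / 2"
      using \<rho>[OF r] by (smt (verit) mult_left_mono min_less_iff_conj)+
    have "H t - y = - (of_real (\<rho> r) * W1 ?u * cis (- (\<beta> + of_int n * t)))"
      unfolding H_def y_def by (simp add: algebra_simps)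
    then have dist: "dist (H t) y < \<delta> / 2"
      using small(1) \<rho>(1)[OF r] by (simp add: dist_norm norm_mult)
    then have y: "y \<notin> \<real>\<^sub>\<le>\<^sub>0" using \<delta>(2)[OF t, of y] \<delta>(1) by fastforce
    have "cmod y > \<delta> / 2"
      using \<delta>(2)[OF t, of 0] dist norm_triangle_ineq2[of "H t" "H t - y"]
      by (simp add: dist_norm)
    then have "?s * (\<delta> / 2) < ?s * cmod y" using s by (intro mult_strict_left_mono)
    moreover have "\<bar>g.offset (r *\<^sub>R ?u)\<bar> = ?s * (\<rho> r * \<bar>P ?u\<bar>)"
      unfolding polar[OF r(1)] using \<rho>(1)[OF r] by (simp add: abs_mult)
    then have "\<bar>g.offset (r *\<^sub>R ?u)\<bar> < ?s * (\<delta> / 2)"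
      using small(2) s by (simp only: mult_strict_left_mono)
    moreover have wy: "g.wdir (r *\<^sub>R ?u) * cis (- (\<beta> + of_int n * t)) = of_real ?s * y"
      unfolding polar[OF r(1)] y_def by (simp only: mult.assoc)
    then have "cmod (g.wdir (r *\<^sub>R ?u)) = ?s * cmod y"
      using s by (metis abs_of_pos norm_cis norm_mult norm_of_real mult.right_neutral)
    moreover have "of_real ?s * y \<notin> \<real>\<^sub>\<le>\<^sub>0"
      using y s by (auto simp: complex_nonpos_Reals_iff mult_le_0_iff)
    ultimately show ?thesis using wy by simp
  qed
  have small: "\<bar>g.offset x\<bar> < cmod (g.wdir x)" if x: "x \<in> ball 0 \<epsilon> - {0}" for x
  proof -
    obtain r t where r: "r > 0" "t \<in> ?I" "x = r *\<^sub>R unit_vec t"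
      using polar_vec2[of x] x by auto
    then have "r < \<epsilon>" using x by simp
    then show ?thesis using est r by simp
  qed
  have c': "continuous_on (ball 0 \<epsilon> - {0}) a" "continuous_on (ball 0 \<epsilon> - {0}) b"
    "continuous_on (ball 0 \<epsilon> - {0}) c"
    using cont by (auto intro: continuous_on_subset)
  have "has_index_at_origin g.flow1 (of_int n / 2)"
    unfolding g.flow1_def[abs_def]
    by (rule has_index_dir[OF \<epsilon> g.continuous_data(2)[OF c'] g.continuous_tilt[OF c' small]])
      (use est in auto)
  moreover have "has_index_at_origin g.flow2 (of_int n / 2)"
    unfolding g.flow2_def[abs_def]
    by (rule has_index_dir[OF \<epsilon> g.continuous_data(2)[OF c']
          continuous_on_diff[OF continuous_on_const g.continuous_tilt[OF c' small]]])
      (use est in auto)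
  ultimately show ?thesis
    using that[OF \<epsilon> g.lorentz_graph_axioms] g.not_umbilic small
      g.curvature_line_flows_graph[OF c' small] by blast
qed

lemma deriv_f_0: "d > 1 \<Longrightarrow> (f has_derivative (\<lambda>v. p x * v $ 1 + q x * v $ 2)) (at x)"
  using deriv_f[of x] homogeneous_has_derivative_0[OF homogeneous_f cont_fpq(1) zero(1)]
  by (cases "x = 0") (auto simp: zero)

text \<open>With \<open>d > 2\<close> the gradient is homogeneous of degree above 1, so it is
  differentiable at the origin with derivative 0, matching the conventional values of
  \<open>a\<close>, \<open>b\<close>, \<open>c\<close> there.\<close>

lemma lorentz_graph_ball:
  assumes "d > 2" "smooth_on UNIV f" "\<epsilon> > 0" and g: "lorentz_graph (ball 0 \<epsilon> - {0}) f p q a b c"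
  shows "lorentz_graph (ball 0 \<epsilon>) f p q a b c"
proof
  show "smooth_on (ball 0 \<epsilon>) f" using assms(2) smooth_on_subset by blast
  fix x :: "real^2" assume x: "x \<in> ball 0 \<epsilon>"
  show "(f has_derivative (\<lambda>v. p x * v $ 1 + q x * v $ 2)) (at x)"
    using deriv_f_0 assms(1) by simp
  show "(p has_derivative (\<lambda>v. a x * v $ 1 + b x * v $ 2)) (at x)"
    using deriv_p[of x] homogeneous_has_derivative_0[OF homogeneous_pq(1) cont_fpq(2) zero(2)] assms(1)
    by (cases "x = 0") (auto simp: zero)
  show "(q has_derivative (\<lambda>v. b x * v $ 1 + c x * v $ 2)) (at x)"
    using deriv_q[of x] homogeneous_has_derivative_0[OF homogeneous_pq(2) cont_fpq(3) zero(3)] assms(1)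
    by (cases "x = 0") (auto simp: zero)
  show "(p x)\<^sup>2 + (q x)\<^sup>2 < 1"
    using lorentz_graph.grad[OF g, of x] x by (cases "x = 0") (auto simp: zero)
qed auto

lemma umbilic_0:
  assumes "lorentz_graph S f p q a b c" "0 \<in> S"
  shows "umbilic (graph_map f) 0"
  unfolding lorentz_graph.umbilic_graph_iff[OF assms]
  by (rule exI[of _ 0]) (simp add: lorentz_graph.hess_def[OF assms(1)] zero)

text \<open>Degree \<open>d > 1\<close> makes \<open>f\<close> differentiable at the origin with
  derivative 0, and the gradient, of degree \<open>d - 1 > 0\<close>, tends to 0 there. The tangent
  plane at the origin is horizontal, hence space-like.\<close>

lemma C1_space_like_graph:
  assumes "d > 1" "\<epsilon> > 0" and g: "lorentz_graph (ball 0 \<epsilon> - {0}) f p q a b c"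
  shows "C1_immersion (ball 0 \<epsilon>) (graph_map f)" "space_like (ball 0 \<epsilon>) (graph_map f)"
proof -
  note deriv = graph_map_has_derivative[OF deriv_f_0[OF assms(1)]]
  have diff: "diff (graph_map f) x = (\<lambda>v. vector [v $ 1, v $ 2, p x * v $ 1 + q x * v $ 2])" for x
    using frechet_derivative_at[OF deriv, of x] by simp
  have "continuous_on UNIV p" "continuous_on UNIV q"
    using homogeneous_isCont_0[OF homogeneous_pq(1) cont_fpq(2) zero(2)]
      homogeneous_isCont_0[OF homogeneous_pq(2) cont_fpq(3) zero(3)] assms(1)
      has_derivative_continuous[OF deriv_p] has_derivative_continuous[OF deriv_q]
    by (auto simp: continuous_on_eq_continuous_at) metis+
  then have cont: "continuous_on (ball 0 \<epsilon>) (\<lambda>x. vector [v $ 1, v $ 2, p x * v $ 1 + q x * v $ 2] :: real^3)"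
    for v :: "real^2"
    unfolding vector3_axis by (auto intro!: continuous_intros intro: continuous_on_subset)
  have "Ck_on (Suc 0) (ball 0 \<epsilon>) (graph_map f)"
    by (rule Ck_on_SucI[OF open_ball deriv]) (use cont in simp)
  then show "C1_immersion (ball 0 \<epsilon>) (graph_map f)"
    unfolding C1_immersion_def inj_def
    by (auto simp: diff vec2_eq_iff vec3_eq_iff vector_3)
  show "space_like (ball 0 \<epsilon>) (graph_map f)"
    unfolding space_like_def
  proof (intro ballI allI impI)
    fix x v :: "real^2" assume x: "x \<in> ball 0 \<epsilon>" and v: "v \<noteq> 0"
    show "first_fundamental_form (graph_map f) x v v > 0"
    proof (cases "x = 0")
      case True
      have "(v $ 1)\<^sup>2 + (v $ 2)\<^sup>2 > 0"
        using v by (auto simp: vec2_eq_iff sum_power2_gt_zero_iff)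
      then show ?thesis
        unfolding first_fundamental_form_def lorentz_def True
        by (simp add: diff vector_3 zero power2_eq_square)
    next
      case False
      then show ?thesis
        using lorentz_graph.space_like_graph[OF g] x v unfolding space_like_def by auto
    qed
  qed
qed

end

section \<open>Linear combinations of jets of a common degree\<close>

lemma homogeneous_jet_add:
  assumes "homogeneous_jet d f p q a b c" "homogeneous_jet d f' p' q' a' b' c'"
  shows "homogeneous_jet d (\<lambda>x. f x + f' x) (\<lambda>x. p x + p' x) (\<lambda>x. q x + q' x)
    (\<lambda>x. a x + a' x) (\<lambda>x. b x + b' x) (\<lambda>x. c x + c' x)"
proof -
  interpret A: homogeneous_jet d f p q a b c by fact
  interpret B: homogeneous_jet d f' p' q' a' b' c' by fact
  show ?thesis
  proof
    fix x :: "real^2" assume x: "x \<noteq> 0"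
    show "((\<lambda>x. f x + f' x) has_derivative (\<lambda>v. (p x + p' x) * v $ 1 + (q x + q' x) * v $ 2)) (at x)"
      using has_derivative_add[OF A.deriv_f[OF x] B.deriv_f[OF x]] by (simp add: algebra_simps)
    show "((\<lambda>x. p x + p' x) has_derivative (\<lambda>v. (a x + a' x) * v $ 1 + (b x + b' x) * v $ 2)) (at x)"
      using has_derivative_add[OF A.deriv_p[OF x] B.deriv_p[OF x]] by (simp add: algebra_simps)
    show "((\<lambda>x. q x + q' x) has_derivative (\<lambda>v. (b x + b' x) * v $ 1 + (c x + c' x) * v $ 2)) (at x)"
      using has_derivative_add[OF A.deriv_q[OF x] B.deriv_q[OF x]] by (simp add: algebra_simps)
  next
    show "homogeneous d (\<lambda>x. f x + f' x)"
      using A.homogeneous_f B.homogeneous_f unfolding homogeneous_def by (simp add: distrib_left)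
  qed (auto simp: A.zero B.zero intro!: smooth_on_add A.smooth B.smooth
      continuous_on_add A.cont B.cont)
qed

lemma homogeneous_jet_cmult:
  assumes "homogeneous_jet d f p q a b c"
  shows "homogeneous_jet d (\<lambda>x. k * f x) (\<lambda>x. k * p x) (\<lambda>x. k * q x)
    (\<lambda>x. k * a x) (\<lambda>x. k * b x) (\<lambda>x. k * c x)"
proof -
  interpret A: homogeneous_jet d f p q a b c by fact
  show ?thesis
  proof
    fix x :: "real^2" assume x: "x \<noteq> 0"
    show "((\<lambda>x. k * f x) has_derivative (\<lambda>v. (k * p x) * v $ 1 + (k * q x) * v $ 2)) (at x)"
      using has_derivative_mult_right[OF A.deriv_f[OF x], of k] by (simp add: algebra_simps)
    show "((\<lambda>x. k * p x) has_derivative (\<lambda>v. (k * a x) * v $ 1 + (k * b x) * v $ 2)) (at x)"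
      using has_derivative_mult_right[OF A.deriv_p[OF x], of k] by (simp add: algebra_simps)
    show "((\<lambda>x. k * q x) has_derivative (\<lambda>v. (k * b x) * v $ 1 + (k * c x) * v $ 2)) (at x)"
      using has_derivative_mult_right[OF A.deriv_q[OF x], of k] by (simp add: algebra_simps)
  next
    show "homogeneous d (\<lambda>x. k * f x)"
      using A.homogeneous_f unfolding homogeneous_def by simp
  qed (auto simp: A.zero intro!: smooth_on_mult smooth_on_const A.smooth
      continuous_on_mult continuous_on_const A.cont)
qed

section \<open>The model functions\<close>

definition zc :: "real^2 \<Rightarrow> complex" where
  "zc x = of_real (x $ 1) + \<i> * of_real (x $ 2)"

definition sqn :: "real^2 \<Rightarrow> real" where
  "sqn x = x $ 1 * x $ 1 + x $ 2 * x $ 2"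

definition rez :: "nat \<Rightarrow> real^2 \<Rightarrow> real" where
  "rez k x = Re (zc x ^ k)"

definition imz :: "nat \<Rightarrow> real^2 \<Rightarrow> real" where
  "imz k x = Im (zc x ^ k)"

text \<open>In polar coordinates this is \<open>r powr (2 * e + k) * cos (k * t)\<close>. The
  exponent \<open>e\<close> may be negative; at the origin \<open>0 powr e = 0\<close> supplies the
  conventional value.\<close>

definition model :: "real \<Rightarrow> nat \<Rightarrow> real^2 \<Rightarrow> real" where
  "model e k x = sqn x powr e * rez k x"

text \<open>Truncation in the indices \<open>k - 1\<close> and \<open>k - 1 - 1\<close>, here and in
  the second derivatives, is harmless: the prefactors \<open>k\<close> and
  \<open>k * (k - 1)\<close> vanish whenever it takes effect.\<close>

definition model_x :: "real \<Rightarrow> nat \<Rightarrow> real^2 \<Rightarrow> real" where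
  "model_x e k x = sqn x powr e * (k * rez (k - 1) x) + sqn x powr (e - 1) * (2 * e * x $ 1 * rez k x)"

definition model_y :: "real \<Rightarrow> nat \<Rightarrow> real^2 \<Rightarrow> real" where
  "model_y e k x = sqn x powr e * (- k * imz (k - 1) x) + sqn x powr (e - 1) * (2 * e * x $ 2 * rez k x)"

definition model_xx :: "real \<Rightarrow> nat \<Rightarrow> real^2 \<Rightarrow> real" where
  "model_xx e k x = sqn x powr e * (k * real (k - 1) * rez (k - 1 - 1) x)
     + sqn x powr (e - 1) * (4 * e * k * x $ 1 * rez (k - 1) x + 2 * e * rez k x)
     + sqn x powr (e - 2) * (4 * e * (e - 1) * x $ 1 * x $ 1 * rez k x)"

definition model_xy :: "real \<Rightarrow> nat \<Rightarrow> real^2 \<Rightarrow> real" where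
  "model_xy e k x = sqn x powr e * (- k * real (k - 1) * imz (k - 1 - 1) x)
     + sqn x powr (e - 1) * (2 * e * k * (x $ 2 * rez (k - 1) x - x $ 1 * imz (k - 1) x))
     + sqn x powr (e - 2) * (4 * e * (e - 1) * x $ 1 * x $ 2 * rez k x)"

definition model_yy :: "real \<Rightarrow> nat \<Rightarrow> real^2 \<Rightarrow> real" where
  "model_yy e k x = sqn x powr e * (- k * real (k - 1) * rez (k - 1 - 1) x)
     + sqn x powr (e - 1) * (- 4 * e * k * x $ 2 * imz (k - 1) x + 2 * e * rez k x)
     + sqn x powr (e - 2) * (4 * e * (e - 1) * x $ 2 * x $ 2 * rez k x)"

section \<open>Derivatives, smoothness and homogeneity of the model functions\<close>

lemma sqn_pos: "x \<noteq> 0 \<Longrightarrow> sqn x > 0"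
  unfolding sqn_def by (auto simp: vec2_eq_iff sum_squares_gt_zero_iff)

lemma sqn_0 [simp]: "sqn 0 = 0"
  by (simp add: sqn_def)

lemma rez_imz_has_derivative:
  shows "(rez k has_derivative (\<lambda>v. k * (rez (k - 1) x * v $ 1 - imz (k - 1) x * v $ 2))) (at x)"
    and "(imz k has_derivative (\<lambda>v. k * (imz (k - 1) x * v $ 1 + rez (k - 1) x * v $ 2))) (at x)"
proof -
  have "(zc has_derivative zc) (at x)"
    unfolding zc_def[abs_def]
    by (intro derivative_intros bounded_linear_imp_has_derivative bounded_linear_vec_nth)
  then have *: "((\<lambda>x. zc x ^ k) has_derivative (\<lambda>v. of_nat k * zc v * zc x ^ (k - 1))) (at x)"
    by (rule has_derivative_power)
  show "(rez k has_derivative (\<lambda>v. k * (rez (k - 1) x * v $ 1 - imz (k - 1) x * v $ 2))) (at x)"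
    unfolding rez_def[abs_def] imz_def
    by (rule has_derivative_eq_rhs[OF bounded_linear.has_derivative[OF bounded_linear_Re *]])
      (auto simp: zc_def algebra_simps)
  show "(imz k has_derivative (\<lambda>v. k * (imz (k - 1) x * v $ 1 + rez (k - 1) x * v $ 2))) (at x)"
    unfolding imz_def[abs_def] rez_def
    by (rule has_derivative_eq_rhs[OF bounded_linear.has_derivative[OF bounded_linear_Im *]])
      (auto simp: zc_def algebra_simps)
qed

lemma sqn_powr_has_derivative:
  assumes "x \<noteq> 0"
  shows "((\<lambda>x. sqn x powr e) has_derivative
    (\<lambda>v. sqn x powr (e - 1) * (2 * e * x $ 1 * v $ 1 + 2 * e * x $ 2 * v $ 2))) (at x)"
proof -
  have "(sqn has_derivative (\<lambda>v. 2 * x $ 1 * v $ 1 + 2 * x $ 2 * v $ 2)) (at x)"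
    unfolding sqn_def[abs_def]
    by (rule has_derivative_eq_rhs[OF has_derivative_add[OF has_derivative_mult has_derivative_mult]])
      (auto intro: bounded_linear_imp_has_derivative bounded_linear_vec_nth)
  from has_derivative_compose[OF this
      has_real_derivative_powr[OF sqn_pos[OF assms], unfolded has_field_derivative_def]]
  show ?thesis by (rule has_derivative_eq_rhs) (simp add: fun_eq_iff algebra_simps)
qed

lemma vec_nth_has_derivative: "((\<lambda>x :: real^2. x $ i) has_derivative (\<lambda>v. v $ i)) (at x)"
  by (intro bounded_linear_imp_has_derivative bounded_linear_vec_nth)

lemma model_has_derivative:
  assumes "x \<noteq> 0"
  shows "(model e k has_derivative (\<lambda>v. model_x e k x * v $ 1 + model_y e k x * v $ 2)) (at x)"
    and "(model_x e k has_derivative (\<lambda>v. model_xx e k x * v $ 1 + model_xy e k x * v $ 2)) (at x)"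
    and "(model_y e k has_derivative (\<lambda>v. model_xy e k x * v $ 1 + model_yy e k x * v $ 2)) (at x)"
proof -
  note D = has_derivative_mult has_derivative_add sqn_powr_has_derivative[OF assms]
    rez_imz_has_derivative vec_nth_has_derivative has_derivative_const
  show "(model e k has_derivative (\<lambda>v. model_x e k x * v $ 1 + model_y e k x * v $ 2)) (at x)"
    unfolding model_def[abs_def]
    by (rule has_derivative_eq_rhs, (rule D)+)
      (simp add: fun_eq_iff model_x_def model_y_def algebra_simps)
  show "(model_x e k has_derivative (\<lambda>v. model_xx e k x * v $ 1 + model_xy e k x * v $ 2)) (at x)"
    unfolding model_x_def[abs_def]
    by (rule has_derivative_eq_rhs, (rule D)+)
      (simp add: fun_eq_iff model_xx_def model_xy_def algebra_simps)
  show "(model_y e k has_derivative (\<lambda>v. model_xy e k x * v $ 1 + model_yy e k x * v $ 2)) (at x)"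
    unfolding model_y_def[abs_def]
    by (rule has_derivative_eq_rhs, (rule D)+)
      (simp add: fun_eq_iff model_yy_def model_xy_def algebra_simps)
qed

lemma smooth_on_rez_imz:
  assumes "open S"
  shows "smooth_on S (rez k) \<and> smooth_on S (imz k)"
proof (induction k)
  case 0
  then show ?case
    unfolding rez_def[abs_def] imz_def[abs_def] by (simp add: smooth_on_const assms)
next
  case (Suc k)
  have r: "rez (Suc k) = (\<lambda>x. x $ 1 * rez k x + (- 1) * (x $ 2 * imz k x))"
    and i: "imz (Suc k) = (\<lambda>x. x $ 1 * imz k x + x $ 2 * rez k x)"
    unfolding rez_def[abs_def] imz_def[abs_def] zc_def by (auto simp: fun_eq_iff)
  show ?case unfolding r i
    using Suc smooth_on_bounded_linear[OF bounded_linear_vec_nth assms]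
    by (intro conjI smooth_on_add smooth_on_mult smooth_on_const assms) auto
qed

lemma smooth_on_sqn: "open S \<Longrightarrow> smooth_on S sqn"
  unfolding sqn_def[abs_def]
  by (intro smooth_on_add smooth_on_mult smooth_on_bounded_linear bounded_linear_vec_nth)

text \<open>For \<open>e = 2\<close> the real power is the polynomial \<open>r ^ 4\<close>, also at
  the origin, so smoothness extends over the point that the rule for \<open>powr\<close>
  excludes.\<close>

lemma smooth_model_2: "smooth_on UNIV (model 2 k)"
proof -
  have "sqn x powr 2 = sqn x * sqn x" for x
    using sqn_pos[of x] by (cases "x = 0") (auto simp: power2_eq_square)
  then have "model 2 k = (\<lambda>x. sqn x * sqn x * rez k x)"
    unfolding model_def[abs_def] by simp
  moreover have "smooth_on UNIV (\<lambda>x. sqn x * sqn x * rez k x)"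
    using smooth_on_rez_imz[of UNIV k] by (intro smooth_on_mult smooth_on_sqn) auto
  ultimately show ?thesis by simp
qed

lemma homogeneous_jet_model:
  "homogeneous_jet (2 * e + k) (model e k) (model_x e k) (model_y e k)
     (model_xx e k) (model_xy e k) (model_yy e k)"
proof
  show "smooth_on (- {0}) (model e k)"
    unfolding model_def[abs_def] using smooth_on_rez_imz[of "- {0}" k]
    by (intro smooth_on_mult smooth_on_powr smooth_on_sqn) (auto simp: sqn_pos)
  show "homogeneous (2 * e + k) (model e k)"
    unfolding homogeneous_def
  proof (intro allI impI)
    fix r :: real and x assume r: "r > 0"
    have "sqn (r *\<^sub>R x) = r powr 2 * sqn x"
      using r by (simp add: sqn_def algebra_simps power2_eq_square)
    moreover have "sqn x \<ge> 0" unfolding sqn_def by simp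
    ultimately have "sqn (r *\<^sub>R x) powr e = r powr (2 * e) * sqn x powr e"
      by (simp add: powr_mult powr_powr)
    moreover have "zc (r *\<^sub>R x) = of_real r * zc x"
      by (simp add: zc_def algebra_simps)
    then have "rez k (r *\<^sub>R x) = r powr k * rez k x"
      unfolding rez_def using r by (simp add: power_mult_distrib powr_realpow flip: of_real_power)
    ultimately show "model e k (r *\<^sub>R x) = r powr (2 * e + k) * model e k x"
      unfolding model_def by (simp add: powr_add)
  qed
  have cs: "continuous_on (- {0}) (\<lambda>x. sqn x powr e')" for e'
  proof (rule continuous_on_powr)
    show "continuous_on (- {0}) sqn" unfolding sqn_def[abs_def] by (intro continuous_intros)
    show "\<forall>x\<in>- {0}. sqn x \<noteq> 0" using sqn_pos by fastforce
  qed (rule continuous_on_const)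
  have cr: "continuous_on (- {0}) (rez j)" "continuous_on (- {0}) (imz j)" for j
    unfolding rez_def[abs_def] imz_def[abs_def] zc_def by (intro continuous_intros)+
  have cx: "continuous_on (- {0}) (\<lambda>x :: real^2. x $ i)" for i
    by (intro continuous_intros)
  show "continuous_on (- {0}) (model_xx e k)" "continuous_on (- {0}) (model_xy e k)"
    "continuous_on (- {0}) (model_yy e k)"
    unfolding model_xx_def[abs_def] model_xy_def[abs_def] model_yy_def[abs_def]
    by (intro continuous_on_const cs cr cx continuous_on_add continuous_on_diff continuous_on_mult)+
next
  fix x :: "real^2" assume "x \<noteq> 0"
  from model_has_derivative[OF this]
  show "(model e k has_derivative (\<lambda>v. model_x e k x * v $ 1 + model_y e k x * v $ 2)) (at x)"
    and "(model_x e k has_derivative (\<lambda>v. model_xx e k x * v $ 1 + model_xy e k x * v $ 2)) (at x)"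
    and "(model_y e k has_derivative (\<lambda>v. model_xy e k x * v $ 1 + model_yy e k x * v $ 2)) (at x)" .
qed (auto simp: model_def model_x_def model_y_def model_xx_def model_xy_def
    model_yy_def)

text \<open>With \<open>z = x + i y\<close>, the left hand side is four times the second derivative of
  the model \<open>(z ^ (e + k) * cnj z ^ e + z ^ e * cnj z ^ (e + k)) / 2\<close> with respect to
  \<open>cnj z\<close>.\<close>

lemma model_on_circle:
  fixes t :: real
  defines "u \<equiv> unit_vec t"
  shows "Complex (model_xx e k u - model_yy e k u) (2 * model_xy e k u)
    = of_real (2 * (e + k) * (e + k - 1)) * cis ((2 - real k) * t)
      + of_real (2 * e * (e - 1)) * cis ((2 + real k) * t)"
proof -
  have s: "sqn u = 1" unfolding sqn_def u_def by (simp flip: power2_eq_square)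
  have "zc u = cis t" unfolding zc_def u_def by (simp add: complex_eq_iff)
  then have N: "rez j u = cos (j * t)" "imz j u = sin (j * t)" for j
    unfolding rez_def imz_def by (simp_all add: Complex.DeMoivre)
  \<comment> \<open>The angle difference needs \<open>real (k - 1) = real k - 1\<close>, which fails
    at \<open>k = 0\<close>; keeping the factor \<open>real k\<close> on both sides covers that
    case.\<close>
  have k1: "real k * cos t * cos (real (k - 1) * t) + real k * sin t * sin (real (k - 1) * t)
      = real k * cos ((2 - real k) * t)"
    "real k * sin t * cos (real (k - 1) * t) - real k * cos t * sin (real (k - 1) * t)
      = real k * sin ((2 - real k) * t)"
  proof -
    have "cos t * cos (real (k - 1) * t) + sin t * sin (real (k - 1) * t) = cos ((2 - real k) * t)
      \<and> sin t * cos (real (k - 1) * t) - cos t * sin (real (k - 1) * t) = sin ((2 - real k) * t)"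
      if "k \<noteq> 0"
    proof -
      have "(2 - real k) * t = t - real (k - 1) * t"
        using that by (simp add: of_nat_diff algebra_simps)
      then show ?thesis by (simp only: cos_diff sin_diff)
    qed
    then show "real k * cos t * cos (real (k - 1) * t) + real k * sin t * sin (real (k - 1) * t)
      = real k * cos ((2 - real k) * t)"
      "real k * sin t * cos (real (k - 1) * t) - real k * cos t * sin (real (k - 1) * t)
      = real k * sin ((2 - real k) * t)"
      by (cases "k = 0"; simp add: mult.assoc flip: distrib_left right_diff_distrib)+
  qed
  have k2: "real k * real (k - 1) * cos (real (k - 1 - 1) * t) = real k * (real k - 1) * cos ((2 - real k) * t)"
    "- (real k * real (k - 1) * sin (real (k - 1 - 1) * t)) = real k * (real k - 1) * sin ((2 - real k) * t)"
  proof -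
    have "real (k - 1 - 1) * t = - ((2 - real k) * t)" if "k \<ge> 2"
      using that by (simp add: of_nat_diff algebra_simps)
    moreover have "k = 0 \<or> k = 1 \<or> k \<ge> 2" by auto
    ultimately show "real k * real (k - 1) * cos (real (k - 1 - 1) * t) = real k * (real k - 1) * cos ((2 - real k) * t)"
    "- (real k * real (k - 1) * sin (real (k - 1 - 1) * t)) = real k * (real k - 1) * sin ((2 - real k) * t)"
      by (auto simp: of_nat_diff simp del: One_nat_def)
  qed
  define A B C D where "A = cos ((2 - real k) * t)" and "B = sin ((2 - real k) * t)"
    and "C = cos (2 * t) * cos (k * t)" and "D = sin (2 * t) * cos (k * t)"
  note ABCD = A_def B_def C_def D_def
  have "model_xx e k u - model_yy e k u
      = 2 * (real k * real (k - 1) * cos (real (k - 1 - 1) * t))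
        + 4 * e * (real k * cos t * cos (real (k - 1) * t) + real k * sin t * sin (real (k - 1) * t))
        + 4 * e * (e - 1) * (((cos t)\<^sup>2 - (sin t)\<^sup>2) * cos (k * t))"
    unfolding model_xx_def model_yy_def s N unfolding u_def
    by (simp add: algebra_simps power2_eq_square)
  then have re: "model_xx e k u - model_yy e k u
      = 2 * (k * (real k - 1) * A) + 4 * e * (k * A) + 4 * e * (e - 1) * C"
    unfolding k1 k2 cos_double[symmetric] ABCD .
  have "2 * model_xy e k u
      = 2 * (- (real k * real (k - 1) * sin (real (k - 1 - 1) * t)))
        + 4 * e * (real k * sin t * cos (real (k - 1) * t) - real k * cos t * sin (real (k - 1) * t))
        + 4 * e * (e - 1) * (2 * sin t * cos t * cos (k * t))"
    unfolding model_xy_def s N unfolding u_def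
    by (simp add: algebra_simps)
  then have im: "2 * model_xy e k u
      = 2 * (k * (real k - 1) * B) + 4 * e * (k * B) + 4 * e * (e - 1) * D"
    unfolding k1 k2 sin_double[symmetric] ABCD .
  have "2 * C = A + cos ((2 + real k) * t)" "2 * D = B + sin ((2 + real k) * t)"
    unfolding ABCD by (simp_all add: left_diff_distrib distrib_right cos_diff cos_add sin_diff sin_add)
  then have CD: "C = (A + cos ((2 + real k) * t)) / 2" "D = (B + sin ((2 + real k) * t)) / 2"
    by simp_all
  show ?thesis
    unfolding re im CD using ABCD(1,2) by (simp add: complex_eq_iff field_simps)
qed

text \<open>After rotation the value is \<open>2 * (2 + k) * (1 + k) + 4 * cis (2 * k * t)\<close>.
  For \<open>k > 0\<close> the constant is at least 12 and exceeds 4; for \<open>k = 0\<close> both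
  frequencies are 2 and the terms add up to 8.\<close>

lemma model_2_slit:
  "Complex (model_xx 2 k (unit_vec t) - model_yy 2 k (unit_vec t)) (2 * model_xy 2 k (unit_vec t))
    * cis (- (0 + of_int (2 - int k) * t)) \<notin> \<real>\<^sub>\<le>\<^sub>0"
proof -
  have "Re (Complex (model_xx 2 k (unit_vec t) - model_yy 2 k (unit_vec t)) (2 * model_xy 2 k (unit_vec t))
      * cis (- (0 + of_int (2 - int k) * t)))
    = 2 * (2 + real k) * (2 + real k - 1) + 4 * cos (2 * real k * t)"
  proof -
    have "(2 + real k) * t + - (0 + of_int (2 - int k) * t) = 2 * real k * t"
      "(2 - real k) * t + - (0 + of_int (2 - int k) * t) = 0"
      by (simp_all add: algebra_simps)
    moreover have "(A * cis x + B * cis y) * cis z = A * cis (x + z) + B * cis (y + z)" for A B x y z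
      by (simp add: distrib_right mult.assoc cis_mult)
    ultimately show ?thesis
      unfolding model_on_circle by (simp only:) simp
  qed
  also have "\<dots> > 0"
  proof (cases "k = 0")
    case False
    then have "(2 + real k) * (2 + real k - 1) \<ge> 3 * 2" by (intro mult_mono) auto
    moreover have "cos (2 * real k * t) \<ge> - 1" by (rule cos_ge_minus_one)
    ultimately show ?thesis by (simp only: mult.assoc)
  qed simp
  finally show ?thesis by (auto simp: complex_nonpos_Reals_iff)
qed

text \<open>Up to \<open>cis (2 * t)\<close> the Hessian value is \<open>2 * X\<close>, and it meets
  the slit only if \<open>X\<close> is a nonnegative multiple of \<open>cis \<psi>\<close>. The
  imaginary part of \<open>X\<close> is opposite in sign to \<open>S\<close>, which leaves only
  \<open>S = 0\<close>. These are the flat extrema of the wave, where \<open>X = - 3 * C\<close>;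
  the negative sign there is also why the starting angle is \<open>pi\<close>.\<close>

lemma flat_wave_slit:
  fixes m :: nat and t :: real
  assumes "m > 0"
  defines "u \<equiv> unit_vec t" and "e1 \<equiv> 3 / 4 - real m / 2" and "e3 \<equiv> 3 / 4 - 3 * real m / 2"
  shows "Complex ((9 * model_xx e1 m u + (- 1) * model_xx e3 (3 * m) u)
      - (9 * model_yy e1 m u + (- 1) * model_yy e3 (3 * m) u))
      (2 * (9 * model_xy e1 m u + (- 1) * model_xy e3 (3 * m) u))
    * cis (- (pi + of_int (2 + int m) * t)) \<notin> \<real>\<^sub>\<le>\<^sub>0" (is "?W * _ \<notin> _")
proof -
  define \<psi> C S K where "\<psi> = m * t" and "C = cos \<psi>" and "S = sin \<psi>"
    and "K = 18 * (real m)\<^sup>2 * S\<^sup>2 - 3 / 2 * (3 - C\<^sup>2)"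
  have CS: "C\<^sup>2 + S\<^sup>2 = 1" unfolding C_def S_def by simp
  \<comment> \<open>With \<open>G s = 9 * cos s - cos (3 * s)\<close>, \<open>2 * X\<close> is
    \<open>- (3 / 4) * G - m^2 * G'' + i * m * G'\<close> at \<psi>. Here
    \<open>G = 4 * (3 * C - C ^ 3)\<close>, \<open>G' = - 12 * S ^ 3\<close> and
    \<open>G'' = - 36 * C * S ^ 2\<close>.\<close>
  define X where "X = Complex (C * K) (- 6 * real m * S ^ 3)"
  have S2: "S\<^sup>2 = 1 - C\<^sup>2" using CS by simp
  have triple: "cos (3 * \<psi>) = 4 * C ^ 3 - 3 * C" "sin (3 * \<psi>) = 3 * S - 4 * S ^ 3"
  proof -
    show "cos (3 * \<psi>) = 4 * C ^ 3 - 3 * C" unfolding C_def by (simp add: cos_treble_cos)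
    have "sin (3 * \<psi>) = sin (2 * \<psi> + \<psi>)" by simp
    also have "\<dots> = 2 * S * C * C + (C\<^sup>2 - S\<^sup>2) * S"
      unfolding sin_add sin_double cos_double C_def S_def ..
    also have "\<dots> = 3 * S - 4 * S ^ 3" using CS by algebra
    finally show "sin (3 * \<psi>) = 3 * S - 4 * S ^ 3" .
  qed
  define p where "p e k = of_real (2 * (e + real k) * (e + real k - 1)) * cis (- (real k * t))
      + of_real (2 * e * (e - 1)) * cis (real k * t)" for e k
  have p: "of_real (2 * (e + real k) * (e + real k - 1)) * cis ((2 - real k) * t)
      + of_real (2 * e * (e - 1)) * cis ((2 + real k) * t) = cis (2 * t) * p e k" for e k
    unfolding p_def distrib_left mult.left_commute[of "cis (2 * t)"] cis_mult
    by (simp add: algebra_simps)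
  have "?W = 9 * Complex (model_xx e1 m u - model_yy e1 m u) (2 * model_xy e1 m u)
      - Complex (model_xx e3 (3 * m) u - model_yy e3 (3 * m) u) (2 * model_xy e3 (3 * m) u)"
    by (simp add: complex_eq_iff)
  also have "\<dots> = cis (2 * t) * (9 * p e1 m - p e3 (3 * m))"
    unfolding u_def model_on_circle p by (simp add: algebra_simps)
  also have "9 * p e1 m - p e3 (3 * m) = 2 * X"
  proof -
    have \<psi>3: "real (3 * m) * t = 3 * \<psi>" unfolding \<psi>_def by simp
    have expand: "9 * p e1 m - p e3 (3 * m)
      = Complex (9 * (2 * (e1 + m) * (e1 + m - 1) + 2 * e1 * (e1 - 1)) * C
          - (2 * (e3 + 3 * m) * (e3 + 3 * m - 1) + 2 * e3 * (e3 - 1)) * cos (3 * \<psi>))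
        (9 * (2 * e1 * (e1 - 1) - 2 * (e1 + m) * (e1 + m - 1)) * S
          - (2 * e3 * (e3 - 1) - 2 * (e3 + 3 * m) * (e3 + 3 * m - 1)) * sin (3 * \<psi>))"
      unfolding p_def \<psi>3 C_def S_def \<psi>_def[symmetric]
      by (simp add: complex_eq_iff algebra_simps)
    \<comment> \<open>With \<open>2 * e + k = 3 / 2\<close>, the two coefficients of a model of
      frequency \<open>k\<close> have sum \<open>k^2 - 3 / 4\<close> and difference
      \<open>- k\<close>; here \<open>k\<close> is \<open>m\<close> and
      \<open>3 * m\<close>.\<close>
    have coeffs: "2 * (e1 + m) * (e1 + m - 1) + 2 * e1 * (e1 - 1) = (real m)\<^sup>2 - 3 / 4"
      "2 * e1 * (e1 - 1) - 2 * (e1 + m) * (e1 + m - 1) = - real m"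
      "2 * (e3 + 3 * m) * (e3 + 3 * m - 1) + 2 * e3 * (e3 - 1) = 9 * (real m)\<^sup>2 - 3 / 4"
      "2 * e3 * (e3 - 1) - 2 * (e3 + 3 * m) * (e3 + 3 * m - 1) = - 3 * real m"
      unfolding e1_def e3_def by (simp_all add: field_simps power2_eq_square)
    have "Complex (9 * ((real m)\<^sup>2 - 3 / 4) * C - (9 * (real m)\<^sup>2 - 3 / 4) * cos (3 * \<psi>))
        (9 * (- real m) * S - (- 3 * real m) * sin (3 * \<psi>)) = 2 * X"
      unfolding triple X_def K_def S2
      by (simp add: complex_eq_iff field_simps power2_eq_square power3_eq_cube)
    then show ?thesis unfolding expand coeffs .
  qed
  finally have W: "?W = cis (2 * t) * (2 * X)" .
  have "cis (2 * t) * cis (- (pi + of_int (2 + int m) * t)) = - cis (- \<psi>)"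
    unfolding cis_mult \<psi>_def by (simp add: complex_eq_iff algebra_simps cos_diff sin_diff)
  then have WX: "?W * cis (- (pi + of_int (2 + int m) * t)) = - 2 * (cis (- \<psi>) * X)"
    unfolding W by (simp add: algebra_simps)
  define l where "l = Re (cis (- \<psi>) * X)"
  show ?thesis
  proof
    assume "?W * cis (- (pi + of_int (2 + int m) * t)) \<in> \<real>\<^sub>\<le>\<^sub>0"
    moreover have "Re Y \<ge> 0 \<and> Im Y = 0" if "- 2 * Y \<in> \<real>\<^sub>\<le>\<^sub>0" for Y
      using that by (simp add: complex_nonpos_Reals_iff)
    ultimately have l: "l \<ge> 0" and im: "Im (cis (- \<psi>) * X) = 0"
      unfolding WX l_def by blast+
    have "X = cis \<psi> * (cis (- \<psi>) * X)" by (simp add: cis_mult flip: mult.assoc)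
    also have "cis (- \<psi>) * X = of_real l" using im by (simp add: complex_eq_iff l_def)
    finally have "C * K = C * l" "- 6 * real m * S ^ 3 = S * l"
      unfolding X_def by (simp_all add: complex_eq_iff C_def S_def)
    show False
    proof (cases "S = 0")
      case True
      then have "C\<^sup>2 = 1" using CS by simp
      then have "C \<noteq> 0" by auto
      then have "l = K" using \<open>C * K = C * l\<close> by simp
      then show False using l True \<open>C\<^sup>2 = 1\<close> by (simp add: K_def)
    next
      case False
      have "S * (l + 6 * real m * S\<^sup>2) = 0"
        using \<open>- 6 * real m * S ^ 3 = S * l\<close>
        by (simp add: power2_eq_square power3_eq_cube algebra_simps)
      then have "l + 6 * real m * S\<^sup>2 = 0" using False by simp
      moreover have "6 * real m * S\<^sup>2 > 0" using False assms(1) by simp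
      ultimately show False using l by linarith
    qed
  qed
qed

theorem theoremA:
  fixes m :: nat
  assumes "m > 0"
  shows
    "(\<exists>(U :: (real^2) set) (g :: real^2 \<Rightarrow> real^3).
        open U \<and> 0 \<in> U \<and> smooth_immersion U g \<and> space_like U g \<and>
        (\<forall>p\<in>U - {0}. \<not> umbilic g p) \<and> umbilic g 0 \<and>
        (\<exists>L1 L2. curvature_line_flows g (U - {0}) L1 L2 \<and>
           has_index_at_origin L1 ((3 - real m) / 2) \<and>
           has_index_at_origin L2 ((3 - real m) / 2)))
     \<and>
     (\<exists>(U :: (real^2) set) (g :: real^2 \<Rightarrow> real^3).
        open U \<and> 0 \<in> U \<and> C1_immersion U g \<and> space_like U g \<and>
        smooth_on (U - {0}) g \<and> (\<forall>p\<in>U - {0}. \<not> umbilic g p) \<and>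
        (\<exists>L1 L2. curvature_line_flows g (U - {0}) L1 L2 \<and>
           has_index_at_origin L1 (1 + real m / 2) \<and>
           has_index_at_origin L2 (1 + real m / 2)))"
proof (rule conjI, goal_cases)
  case 1
  \<comment> \<open>The winding number \<open>2 - k\<close> has to be \<open>3 - m\<close>;
    \<open>k = 0\<close> is allowed and gives the rotationally symmetric
    \<open>r ^ 4\<close>.\<close>
  define k where "k = m - 1"
  interpret jet: homogeneous_jet "2 * 2 + real k" "model 2 k" "model_x 2 k" "model_y 2 k"
    "model_xx 2 k" "model_xy 2 k" "model_yy 2 k"
    by (rule homogeneous_jet_model)
  have n: "of_int (2 - int k) / 2 = (3 - real m) / 2"
    using assms unfolding k_def by (simp add: of_nat_diff)
  obtain \<epsilon> where \<epsilon>: "\<epsilon> > 0"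
    "lorentz_graph (ball 0 \<epsilon> - {0}) (model 2 k) (model_x 2 k) (model_y 2 k)
      (model_xx 2 k) (model_xy 2 k) (model_yy 2 k)"
    "\<And>x. x \<in> ball 0 \<epsilon> - {0} \<Longrightarrow> \<not> umbilic (graph_map (model 2 k)) x"
    "\<exists>L1 L2. curvature_line_flows (graph_map (model 2 k)) (ball 0 \<epsilon> - {0}) L1 L2 \<and>
       has_index_at_origin L1 ((3 - real m) / 2) \<and> has_index_at_origin L2 ((3 - real m) / 2)"
    using jet.flows_exist[OF _ model_2_slit, unfolded n] by auto
  have ball: "lorentz_graph (ball 0 \<epsilon>) (model 2 k) (model_x 2 k) (model_y 2 k)
      (model_xx 2 k) (model_xy 2 k) (model_yy 2 k)"
    by (rule jet.lorentz_graph_ball[OF _ smooth_model_2 \<epsilon>(1,2)]) simp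
  show ?case
  proof (intro exI[of _ "ball 0 \<epsilon>"] exI[of _ "graph_map (model 2 k)"] conjI)
    show "smooth_immersion (ball 0 \<epsilon>) (graph_map (model 2 k))"
      using lorentz_graph.smooth_immersion_graph[OF ball] .
    show "space_like (ball 0 \<epsilon>) (graph_map (model 2 k))"
      using lorentz_graph.space_like_graph[OF ball] .
    show "umbilic (graph_map (model 2 k)) 0"
      by (rule jet.umbilic_0[OF ball]) (simp add: \<epsilon>(1))
  qed (use \<epsilon> in auto)
next
  case 2
  \<comment> \<open>Both exponents solve \<open>2 * e + k = 3 / 2\<close>, for the frequencies
    \<open>m\<close> and \<open>3 * m\<close>, so the two models have a common degree.\<close>
  define e1 e3 where "e1 = 3 / 4 - real m / 2" and "e3 = 3 / 4 - 3 * real m / 2"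
  note jet1 = homogeneous_jet_cmult[OF homogeneous_jet_model[of e1 m], of 9]
  note jet3 = homogeneous_jet_cmult[OF homogeneous_jet_model[of e3 "3 * m"], of "- 1"]
  have d: "2 * e1 + real m = 3 / 2" "2 * e3 + real (3 * m) = 3 / 2"
    unfolding e1_def e3_def by simp_all
  define f where "f x = 9 * model e1 m x + (- 1) * model e3 (3 * m) x" for x
  interpret jet: homogeneous_jet "3 / 2" f
    "\<lambda>x. 9 * model_x e1 m x + (- 1) * model_x e3 (3 * m) x"
    "\<lambda>x. 9 * model_y e1 m x + (- 1) * model_y e3 (3 * m) x"
    "\<lambda>x. 9 * model_xx e1 m x + (- 1) * model_xx e3 (3 * m) x"
    "\<lambda>x. 9 * model_xy e1 m x + (- 1) * model_xy e3 (3 * m) x"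
    "\<lambda>x. 9 * model_yy e1 m x + (- 1) * model_yy e3 (3 * m) x"
    unfolding f_def[abs_def]
    by (rule homogeneous_jet_add[OF jet1[unfolded d] jet3[unfolded d]])
  have n: "of_int (2 + int m) / 2 = 1 + real m / 2" by simp
  have d1: "(3 / 2 :: real) > 1" by simp
  show ?case
  proof (rule jet.flows_exist[OF d1 flat_wave_slit[OF assms, folded e1_def e3_def], unfolded n])
    fix \<epsilon> :: real
    assume \<epsilon>: "\<epsilon> > 0"
      and g: "lorentz_graph (ball 0 \<epsilon> - {0}) f
        (\<lambda>x. 9 * model_x e1 m x + (- 1) * model_x e3 (3 * m) x)
        (\<lambda>x. 9 * model_y e1 m x + (- 1) * model_y e3 (3 * m) x)
        (\<lambda>x. 9 * model_xx e1 m x + (- 1) * model_xx e3 (3 * m) x)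
        (\<lambda>x. 9 * model_xy e1 m x + (- 1) * model_xy e3 (3 * m) x)
        (\<lambda>x. 9 * model_yy e1 m x + (- 1) * model_yy e3 (3 * m) x)"
      and umb: "\<And>x. x \<in> ball 0 \<epsilon> - {0} \<Longrightarrow> \<not> umbilic (graph_map f) x"
      and flows: "\<exists>L1 L2. curvature_line_flows (graph_map f) (ball 0 \<epsilon> - {0}) L1 L2 \<and>
       has_index_at_origin L1 (1 + real m / 2) \<and> has_index_at_origin L2 (1 + real m / 2)"
    show ?case
    proof (intro exI[of _ "ball 0 \<epsilon>"] exI[of _ "graph_map f"] conjI)
      show "C1_immersion (ball 0 \<epsilon>) (graph_map f)" "space_like (ball 0 \<epsilon>) (graph_map f)"
        using jet.C1_space_like_graph[OF d1 \<epsilon> g] .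
      show "smooth_on (ball 0 \<epsilon> - {0}) (graph_map f)"
        using lorentz_graph.smooth_immersion_graph[OF g] unfolding smooth_immersion_def by blast
    qed (use \<epsilon> umb flows in auto)
  qed
qed

end
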